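(* Let $\mathcal H$ be a real separable Hilbert space, let $\beta\in\,]0,+\infty[$, let $U\colon\mathcal H\to\mathcal H$ be a bounded linear self-adjoint strongly positive operator, let $A\colon\mathcal H\to 2^{\mathcal H}$ be maximally monotone, and let $B\colon\mathcal H\to\mathcal H$ be such that $$(\forall (x,y)\in\mathcal H^2)\qquad \langle x-y\mid Bx-By\rangle\ \ge\ \beta\,\langle Bx-By\mid U(Bx-By)\rangle .$$ Suppose that the set $\mathcal P=\{x\in\mathcal H : 0\in Ax+Bx\}$ is non-empty. Let $\varepsilon\in\,]0,\min\{1,\beta\}[$, let $(\gamma_n)_{n\in\mathbb N}$ be a sequence in $[\varepsilon,(2-\varepsilon)\beta]$, let $(\lambda_n)_{n\in\mathbb N}$ be a sequence in $[\varepsilon,1]$, and let $(\alpha_n)_{n\in\mathbb N}$ be a sequence in $[0,1-\varepsilon]$. Let $(r_n)_{n\in\mathbb N}$ be an $\mathcal H$-valued square integrable random process, let $x_0$ be an $\mathcal H$-valued square integrable random variable, set $x_{-1}=x_0$, and for every $n\in\mathbb N$ set $$\begin{aligned} w_n&=x_n+\alpha_n(x_n-x_{n-1}),\\ z_n&=w_n-\gamma_nUr_n,\\ p_n&=J_{\gamma_nUA}(z_n),\\ x_{n+1}&=x_n+\lambda_n(p_n-x_n).\end{aligned}$$ For every $n\in\mathbb N$ let $\mathcal F_n=\sigma(x_0,\ldots,x_n)$. Suppose that (a) for every $n\in\mathbb N$, $\mathsf E[r_n\mid\mathcal F_n]=Bw_n$ a.s.; (b) $\sum_{n\in\mathbb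 N}\mathsf E\big[\|r_n-Bw_n\|^2\mid\mathcal F_n\big]<+\infty$ a.s.; (c) $\sup_{n\in\mathbb N}\|x_n-x_{n-1}\|^2<+\infty$ a.s. and $\sum_{n\in\mathbb N}\alpha_n<+\infty$. Then there exists an a.s. $\mathcal P$-valued random variable $\overline x$ such that the following hold. (i) $x_n\rightharpoonup\overline x$ a.s. (ii) $Bx_n\to B\overline x$ a.s. (iii) If $B$ is demiregular at $\overline x$, then $x_n\to\overline x$ a.s.
   Context: All random variables are defined on a probability space $(\Omega,\mathcal F,\mathsf P)$; an $\mathcal H$-valued random variable is a measurable map $\Omega\to\mathcal H$ ($\mathcal H$ with its Borel $\sigma$-algebra), and an $\mathcal H$-valued random process is a sequence of $\mathcal H$-valued random variables. $\sigma(x_0,\ldots,x_n)$ is the generated $\sigma$-field; a.s. means almost surely. $\rightharpoonup$ and $\to$ denote weak and strong convergence. A self-adjoint bounded linear operator $U$ is strongly positive if there is $\chi>0$ with $\langle Ux\mid x\rangle\ge\chi\|x\|^2$ for all $x$. For a set-valued operator $A\colon\mathcal H\to2^{\mathcal H}$, $\operatorname{gra}A=\{(x,u): u\in Ax\}$; $A$ is monotone if $\langle x-y\mid u-v\rangle\ge0$ for all $(x,u),(y,v)\in\operatorname{gra}A$, and maximally monotone if in addition its graph is not properly contained in the graph of another monotone operator. The resolvent is $J_A=(\operatorname{Id}+A)^{-1}$; $J_{\gamma UA}=(\operatorname{Id}+\gamma UA)^{-1}$, where $(UA)x=\{Uu:u\in Ax\}$, is single-valued and defined on all of $\mathcal H$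 when $A$ is maximally monotone, $\gamma>0$, and $U$ is self-adjoint and strongly positive. An operator $A$ is demiregular at $y\in\operatorname{dom}A$ if for every sequence $(y_n,v_n)_{n\in\mathbb N}$ in $\operatorname{gra}A$ and every $v\in Ay$, $(y_n\rightharpoonup y$ and $v_n\to v)$ implies $y_n\to y$. For a random $\overline x$, "$B$ is demiregular at $\overline x$" means that $B$ is demiregular at $\overline x(\omega)$ for almost every $\omega\in\Omega$. *)

theory Defs
  imports "HOL-Probability.Probability"
begin

text \<open>
  A real separable Hilbert space is a type of sort
  \<open>{real_inner, banach, second_countable_topology}\<close>; for metric spaces, second
  countability is the same as separability.  Set-valued operators are functions
  \<open>'h \<Rightarrow> 'h set\<close>.
\<close>

definition self_adjoint :: "('h::real_inner \<Rightarrow> 'h) \<Rightarrow> bool" where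
  "self_adjoint U \<longleftrightarrow> (\<forall>x y. U x \<bullet> y = x \<bullet> U y)"

definition strongly_positive :: "('h::real_inner \<Rightarrow> 'h) \<Rightarrow> bool" where
  "strongly_positive U \<longleftrightarrow> (\<exists>c>0. \<forall>x. U x \<bullet> x \<ge> c * (norm x)\<^sup>2)"

definition gra :: "('h \<Rightarrow> 'h set) \<Rightarrow> ('h \<times> 'h) set" where
  "gra A = {(x, u). u \<in> A x}"

definition dom_op :: "('h \<Rightarrow> 'h set) \<Rightarrow> 'h set" where
  "dom_op A = {x. A x \<noteq> {}}"

definition monotone_op :: "('h::real_inner \<Rightarrow> 'h set) \<Rightarrow> bool" where
  "monotone_op A \<longleftrightarrow> (\<forall>(x, u)\<in>gra A. \<forall>(y, v)\<in>gra A. (x - y) \<bullet> (u - v) \<ge> 0)"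

definition maximally_monotone :: "('h::real_inner \<Rightarrow> 'h set) \<Rightarrow> bool" where
  "maximally_monotone A \<longleftrightarrow>
     monotone_op A \<and> (\<nexists>A'. monotone_op A' \<and> gra A \<subset> gra A')"

definition scaled_op :: "real \<Rightarrow> ('h::real_vector \<Rightarrow> 'h) \<Rightarrow> ('h \<Rightarrow> 'h set) \<Rightarrow> 'h \<Rightarrow> 'h set" where
  "scaled_op \<gamma> U A x = {\<gamma> *\<^sub>R U u |u. u \<in> A x}"

text \<open>
  The resolvent is the inverse of \<open>Id + A\<close> in the sense of relations, hence itself a
  set-valued operator.  When it is single-valued, \<open>p = J z\<close> is expressed as
  \<open>p \<in> resolvent A z\<close>.
\<close>

definition resolvent :: "('h::real_vector \<Rightarrow> 'h set) \<Rightarrow> 'h \<Rightarrow> 'h set" where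
  "resolvent A z = {p. z \<in> {p + u |u. u \<in> A p}}"

text \<open>By the Riesz representation theorem, inner products give all continuous functionals.\<close>

definition weakly_tendsto :: "(nat \<Rightarrow> 'h::real_inner) \<Rightarrow> 'h \<Rightarrow> bool" where
  "weakly_tendsto x l \<longleftrightarrow> (\<forall>h. (\<lambda>n. x n \<bullet> h) \<longlonglongrightarrow> l \<bullet> h)"

definition demiregular_at :: "('h::real_inner \<Rightarrow> 'h set) \<Rightarrow> 'h \<Rightarrow> bool" where
  "demiregular_at A y \<longleftrightarrow> y \<in> dom_op A \<and>
     (\<forall>ys vs v. (\<forall>n. (ys n, vs n) \<in> gra A) \<longrightarrow> v \<in> A y \<longrightarrow>
        weakly_tendsto ys y \<longrightarrow> vs \<longlonglongrightarrow> v \<longrightarrow> ys \<longlonglongrightarrow> y)"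

definition square_integrable_rv ::
    "'o measure \<Rightarrow> ('o \<Rightarrow> 'h::{real_normed_vector, second_countable_topology}) \<Rightarrow> bool" where
  "square_integrable_rv M f \<longleftrightarrow>
     f \<in> borel_measurable M \<and> integrable M (\<lambda>\<omega>. (norm (f \<omega>))\<^sup>2)"

definition history :: "'o measure \<Rightarrow> (nat \<Rightarrow> 'o \<Rightarrow> 'h::topological_space) \<Rightarrow> nat \<Rightarrow> 'o measure" where
  "history M x n =
     sigma (space M) (\<Union>i\<in>{..n}. {x i -` S \<inter> space M |S. S \<in> sets borel})"

text \<open>
  \<open>HOL-Probability\<close> only provides conditional expectations of real and extended
  nonnegative functions.  For vector-valued functions, \<open>g\<close> is a version of the
  conditional expectation of \<open>f\<close> given \<open>F\<close> if it is \<open>F\<close>-measurable, Bochner integrable,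
  and has the same Bochner integral as \<open>f\<close> over every set in \<open>F\<close>.
\<close>

definition is_cond_exp ::
    "'o measure \<Rightarrow> 'o measure \<Rightarrow> ('o \<Rightarrow> 'h::{banach, second_countable_topology}) \<Rightarrow> ('o \<Rightarrow> 'h) \<Rightarrow> bool" where
  "is_cond_exp M F f g \<longleftrightarrow>
     subalgebra M F \<and> integrable M f \<and> g \<in> borel_measurable F \<and> integrable M g \<and>
     (\<forall>S\<in>sets F. set_lebesgue_integral M S g = set_lebesgue_integral M S f)"

text \<open>The predecessor \<open>x\<^sub>n\<^sub>-\<^sub>1\<close>, with the convention \<open>x\<^sub>-\<^sub>1 = x\<^sub>0\<close>.\<close>

definition prev :: "(nat \<Rightarrow> 'b) \<Rightarrow> nat \<Rightarrow> 'b" where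
  "prev x n = (case n of 0 \<Rightarrow> x 0 | Suc m \<Rightarrow> x m)"

end

theory Submission
  imports Defs "HOL-Complex_Analysis.Great_Picard"
begin

text \<open>
  The iteration is an inertial forward-backward algorithm, and the theorem is true because its
  orbits are stochastically quasi-Fejer monotone with respect to the set of zeros, in the right
  metric.  That metric is \<open>Q v = v \<bullet> V v\<close> with \<open>V = U\<inverse>\<close>: the operator
  \<open>UA\<close> is monotone for \<open>Q\<close> although it need not be monotone for the original norm, and \<open>UB\<close> is
  cocoercive for \<open>Q\<close>.  For a zero \<open>y\<close>, firm nonexpansiveness of the resolvent (backward step),
  cocoercivity (forward step) and convexity (relaxation) combine, for each outcome, to the
  inequality \<open>iteration_step\<close>: up to a factor \<open>1 + \<alpha>\<^sub>n\<close> and an inertial term, \<open>Q (x\<^sub>n - y)\<close> decreases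
  by a multiple of \<open>\<parallel>B w\<^sub>n - B y\<parallel>\<^sup>2\<close> and of a squared backward residual, except for a quadratic
  noise term and a cross term linear in the noise \<open>r\<^sub>n - B w\<^sub>n\<close>.  The cross term has zero integral over
  every event of the past, because the noise is conditionally centred (\<open>integral_inner_eq_0\<close>).

  The Robbins-Siegmund theorem (\<open>robbins_siegmund\<close>) then gives, almost surely, convergence of
  \<open>Q (x\<^sub>n - y)\<close> and summability of the residuals.  It rests on the almost sure convergence of
  nonnegative supermartingales, proved by counting upcrossings; all conditional inequalities are
  written as inequalities between integrals over events of the past.  The squared noise
  \<open>\<parallel>r\<^sub>n - B w\<^sub>n\<parallel>\<^sup>2\<close> itself is counted among the residuals, so the same application shows that the noise
  tends to zero along almost every path, which makes the remaining argument deterministic.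

  Along such a path (\<open>pathwise_convergence\<close>) there are \<open>a\<^sub>n \<in> A p\<^sub>n\<close> with \<open>a\<^sub>n\<close> tending to \<open>- B y\<close> and
  \<open>p\<^sub>n - x\<^sub>n\<close> tending to \<open>0\<close>; the weak-strong closedness of the graph of \<open>A\<close> and the cocoercivity of
  \<open>B\<close> force every weak cluster point of \<open>x\<^sub>n\<close> to be a zero, and Opial's argument leaves only one.
  Separability of the space makes a countable dense set of zeros \<open>y\<close> sufficient, so that the
  exceptional null sets add up to a null set; it also gives weakly convergent subsequences of bounded
  sequences by a diagonal argument, and Borel measurability of the weak limit from that of its inner
  products with fixed vectors.
\<close>

section \<open>Weak convergence in separable Hilbert spaces\<close>

text \<open>
  Minimising \<open>J y = \<parallel>y\<parallel>\<^sup>2 - 2 \<phi> y\<close> works in any Hilbert space: by the parallelogram law every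
  minimising sequence is Cauchy, and the first-order condition at the limit is the claim.
\<close>

lemma riesz_representation:
  fixes \<phi> :: "'h::{real_inner, banach} \<Rightarrow> real"
  assumes "bounded_linear \<phi>"
  shows "\<exists>y. \<forall>h. \<phi> h = y \<bullet> h"
proof -
  interpret \<phi>: bounded_linear \<phi> by fact
  obtain K where K: "\<And>h. \<bar>\<phi> h\<bar> \<le> norm h * K"
    using \<phi>.bounded by (metis real_norm_def)
  define J where "J y = (norm y)\<^sup>2 - 2 * \<phi> y" for y
  define m where "m = Inf (range J)"
  have "- (K\<^sup>2) \<le> J y" for y
  proof -
    have "\<phi> y \<le> norm y * K" using K[of y] by linarith
    moreover have "0 \<le> (norm y - K)\<^sup>2" by simp
    ultimately show ?thesis unfolding J_def by (simp add: power2_diff)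
  qed
  then have "bdd_below (range J)" by (intro bdd_belowI2)
  then have m_le: "m \<le> J y" for y unfolding m_def by (simp add: cInf_lower)
  have "\<exists>y. J y < m + 1 / Suc n" for n
    using cInf_lessD[of "range J" "m + 1 / Suc n"] unfolding m_def by auto
  then obtain y where y: "\<And>n. J (y n) < m + 1 / Suc n" by metis
  have par: "(norm (a - b))\<^sup>2 \<le> 2 * (J a - m) + 2 * (J b - m)" for a b
  proof -
    have "J a + J b = 2 * J ((1/2) *\<^sub>R (a + b)) + (norm (a - b))\<^sup>2 / 2"
      unfolding J_def power2_norm_eq_inner
      by (simp add: \<phi>.scaleR \<phi>.add inner_simps inner_commute field_simps)
    with m_le[of "(1/2) *\<^sub>R (a + b)"] show ?thesis by argo
  qed
  have "Cauchy y"
  proof (rule metric_CauchyI)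
    fix e :: real assume "e > 0"
    then obtain N where N: "4 / e\<^sup>2 < real N" using reals_Archimedean2 by blast
    have "dist (y i) (y j) < e" if "i \<ge> N" "j \<ge> N" for i j
    proof -
      have small: "1 / real (Suc k) < e\<^sup>2 / 4" if "k \<ge> N" for k
      proof -
        have "4 / e\<^sup>2 < real (Suc k)" using N that by linarith
        then show ?thesis using \<open>e > 0\<close> by (simp add: field_simps)
      qed
      have "J (y k) < m + e\<^sup>2 / 4" if "k \<ge> N" for k
        using y add_strict_left_mono[OF small[OF that]] by (rule order.strict_trans)
      from this[OF that(1)] this[OF that(2)] have "(norm (y i - y j))\<^sup>2 < e\<^sup>2"
        using par[of "y i" "y j"] by argo
      then show ?thesis using \<open>e > 0\<close> by (simp add: dist_norm power_less_imp_less_base)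
    qed
    then show "\<exists>N. \<forall>i\<ge>N. \<forall>j\<ge>N. dist (y i) (y j) < e" by blast
  qed
  then obtain l where l: "y \<longlonglongrightarrow> l" using Cauchy_convergent convergent_def by blast
  have "(\<lambda>n. J (y n)) \<longlonglongrightarrow> J l"
    unfolding J_def by (intro tendsto_intros \<phi>.tendsto l)
  moreover have "(\<lambda>n. m + 1 / real (Suc n)) \<longlonglongrightarrow> m"
    using tendsto_add[OF tendsto_const LIMSEQ_inverse_real_of_nat, of m] by (simp add: inverse_eq_divide)
  ultimately have "J l \<le> m" using y less_imp_le by (intro LIMSEQ_le) auto
  have "\<phi> h = l \<bullet> h" for h
  proof -
    define c where "c = l \<bullet> h - \<phi> h"
    define s where "s = (norm h)\<^sup>2"
    \<comment> \<open>The exact minimiser along \<open>h\<close> would be the step \<open>c / s\<close>; adding 1 to the denominator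
        also covers \<open>h = 0\<close>.\<close>
    define u where "u = c / (s + 1)"
    have "s \<ge> 0" by (simp add: s_def)
    then have c: "c = u * (s + 1)" by (simp add: u_def)
    have "J (l + (- u) *\<^sub>R h) = J l - 2 * u * c + u\<^sup>2 * s"
      unfolding J_def c_def s_def power2_norm_eq_inner
      by (simp add: \<phi>.diff \<phi>.scaleR inner_simps inner_commute power2_eq_square algebra_simps)
    with m_le[of "l + (- u) *\<^sub>R h"] \<open>J l \<le> m\<close> have "0 \<le> - 2 * u * c + u\<^sup>2 * s" by linarith
    also have "\<dots> = - (u\<^sup>2 * (s + 2))"
      unfolding c by (simp add: algebra_simps power2_eq_square)
    finally have "u\<^sup>2 * (s + 2) \<le> 0" by simp
    then have "u = 0" using \<open>s \<ge> 0\<close> by (simp add: mult_le_0_iff)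
    then have "c = 0" using c by simp
    then show ?thesis by (simp add: c_def)
  qed
  then show ?thesis by blast
qed

text \<open>
  On a bounded sequence, convergence of inner products passes to closures of the set of test
  vectors.  It is used twice: from a countable dense set to the whole space, and from a countable
  set of zeros to all zeros.
\<close>

lemma bounded_inner_convergent_closure:
  fixes x :: "nat \<Rightarrow> 'h::real_inner"
  assumes bd: "\<And>n. norm (x n) \<le> C"
    and conv: "\<And>d. d \<in> D \<Longrightarrow> convergent (\<lambda>n. x n \<bullet> d)"
    and h: "h \<in> closure D"
  shows "convergent (\<lambda>n. x n \<bullet> h)"
proof -
  have "Cauchy (\<lambda>n. x n \<bullet> h)"
  proof (rule metric_CauchyI)
    fix e :: real assume "e > 0"
    have "C \<ge> 0" using bd[of 0] norm_ge_zero order_trans by blast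
    then have "e / (3 * (C + 1)) > 0" using \<open>e > 0\<close> by simp
    then obtain d where d: "d \<in> D" "dist d h < e / (3 * (C + 1))"
      using h closure_approachable by blast
    have near: "\<bar>x n \<bullet> h - x n \<bullet> d\<bar> \<le> e / 3" for n
    proof -
      have "\<bar>x n \<bullet> h - x n \<bullet> d\<bar> \<le> norm (x n) * norm (h - d)"
        by (metis Cauchy_Schwarz_ineq2 inner_diff_right)
      also have "\<dots> \<le> (C + 1) * (e / (3 * (C + 1)))"
        using bd[of n] d \<open>C \<ge> 0\<close> by (intro mult_mono) (auto simp: dist_norm norm_minus_commute)
      also have "(C + 1) * (e / (3 * (C + 1))) = e / 3"
        using \<open>C \<ge> 0\<close> by (simp add: divide_simps)
      finally show ?thesis .
    qed
    have "Cauchy (\<lambda>n. x n \<bullet> d)" using conv d(1) convergent_Cauchy by blast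
    then obtain N where N: "\<And>i j. i \<ge> N \<Longrightarrow> j \<ge> N \<Longrightarrow> dist (x i \<bullet> d) (x j \<bullet> d) < e / 3"
      using metric_CauchyD[of _ "e/3"] \<open>e > 0\<close> by (metis divide_pos_pos zero_less_numeral)
    have "dist (x i \<bullet> h) (x j \<bullet> h) < e" if "i \<ge> N" "j \<ge> N" for i j
      using N[OF that] near[of i] near[of j] unfolding dist_real_def by argo
    then show "\<exists>N. \<forall>i\<ge>N. \<forall>j\<ge>N. dist (x i \<bullet> h) (x j \<bullet> h) < e" by blast
  qed
  then show ?thesis by (simp add: Cauchy_convergent)
qed

text \<open>
  A diagonal sequence makes the inner products with a countable dense set converge.  Their limits
  define a bounded linear functional, which is represented by the weak limit.
\<close>

lemma weak_sequential_compactness: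
  fixes x :: "nat \<Rightarrow> 'h::{real_inner, banach, second_countable_topology}"
  assumes bd: "\<And>n. norm (x n) \<le> C"
  obtains s l where "strict_mono s" "weakly_tendsto (x \<circ> s) l"
proof -
  obtain D :: "'h set" where D: "countable D" "UNIV \<subseteq> closure D"
    using separable[of UNIV] by metis
  \<comment> \<open>The diagonal argument asks for one bound for all test vectors, hence the normalisation.\<close>
  define f where "f n h = x n \<bullet> (h /\<^sub>R norm h)" for n h
  have f_bd: "norm (f n h) \<le> C" for n h
  proof -
    have "\<bar>f n h\<bar> \<le> norm (x n) * norm (h /\<^sub>R norm h)"
      unfolding f_def by (rule Cauchy_Schwarz_ineq2)
    also have "\<dots> \<le> norm (x n) * 1" by (intro mult_left_mono, cases "h = 0") simp_all
    finally show ?thesis using bd[of n] by simp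
  qed
  obtain s where s: "strict_mono s" "\<And>d. d \<in> D \<Longrightarrow> \<exists>a. (\<lambda>n. f (s n) d) \<longlonglongrightarrow> a"
    using function_convergent_subsequence[where S = D and f = f and M = C] D(1) f_bd by blast
  have xs: "norm ((x \<circ> s) n) \<le> C" for n using bd by simp
  have "convergent (\<lambda>n. (x \<circ> s) n \<bullet> d)" if dD: "d \<in> D" for d
  proof -
    from s(2)[OF dD] obtain a where "(\<lambda>n. f (s n) d) \<longlonglongrightarrow> a" by blast
    then have "(\<lambda>n. norm d * f (s n) d) \<longlonglongrightarrow> norm d * a" by (rule tendsto_mult_left)
    moreover have "norm d * f (s n) d = (x \<circ> s) n \<bullet> d" for n
      unfolding f_def by (cases "d = 0") auto
    ultimately show ?thesis by (auto simp: convergent_def)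
  qed
  then have conv: "convergent (\<lambda>n. (x \<circ> s) n \<bullet> h)" for h
    using bounded_inner_convergent_closure[where x = "x \<circ> s" and C = C and D = D and h = h] xs D(2)
    by blast
  define \<phi> where "\<phi> h = lim (\<lambda>n. (x \<circ> s) n \<bullet> h)" for h
  have lim: "(\<lambda>n. (x \<circ> s) n \<bullet> h) \<longlonglongrightarrow> \<phi> h" for h
    unfolding \<phi>_def using conv convergent_LIMSEQ_iff by blast
  have "bounded_linear \<phi>"
  proof (rule bounded_linear_intro)
    show "\<phi> (g + h) = \<phi> g + \<phi> h" for g h
      using tendsto_add[OF lim[of g] lim[of h]] LIMSEQ_unique[OF lim[of "g + h"]]
      by (simp add: inner_add_right)
    show "\<phi> (c *\<^sub>R h) = c *\<^sub>R \<phi> h" for c h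
      using tendsto_mult_left[OF lim[of h], of c] LIMSEQ_unique[OF lim[of "c *\<^sub>R h"]] by simp
    show "norm (\<phi> h) \<le> norm h * C" for h
    proof (rule Lim_bounded)
      show "(\<lambda>n. norm ((x \<circ> s) n \<bullet> h)) \<longlonglongrightarrow> norm (\<phi> h)" by (intro tendsto_norm lim)
      have "norm ((x \<circ> s) n \<bullet> h) \<le> norm h * C" for n
      proof -
        have "norm ((x \<circ> s) n \<bullet> h) \<le> norm ((x \<circ> s) n) * norm h"
          using Cauchy_Schwarz_ineq2 by simp
        also have "\<dots> \<le> C * norm h" using xs by (intro mult_right_mono) auto
        finally show ?thesis by (simp add: mult.commute)
      qed
      then show "\<forall>n\<ge>0. norm ((x \<circ> s) n \<bullet> h) \<le> norm h * C" by blast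
    qed
  qed
  then obtain l where "\<And>h. \<phi> h = l \<bullet> h" using riesz_representation by blast
  then have "weakly_tendsto (x \<circ> s) l" using lim unfolding weakly_tendsto_def by simp
  with s(1) show ?thesis by (rule that)
qed

lemma weakly_tendsto_add_null:
  assumes "weakly_tendsto x l" "d \<longlonglongrightarrow> 0"
  shows "weakly_tendsto (\<lambda>n. x n + d n) l"
  unfolding weakly_tendsto_def
proof
  fix h
  have "(\<lambda>n. x n \<bullet> h) \<longlonglongrightarrow> l \<bullet> h" using assms(1) unfolding weakly_tendsto_def by blast
  from tendsto_add[OF this tendsto_inner[OF assms(2) tendsto_const]]
  have "(\<lambda>n. x n \<bullet> h + d n \<bullet> h) \<longlonglongrightarrow> l \<bullet> h + 0 \<bullet> h" .
  then show "(\<lambda>n. (x n + d n) \<bullet> h) \<longlonglongrightarrow> l \<bullet> h" by (simp add: inner_add_left)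
qed

lemma weak_strong_inner:
  assumes bd: "\<And>n. norm (x n) \<le> C" and "weakly_tendsto x l" and b: "b \<longlonglongrightarrow> c"
  shows "(\<lambda>n. x n \<bullet> b n) \<longlonglongrightarrow> l \<bullet> c"
proof -
  have "(\<lambda>n. x n \<bullet> (b n - c)) \<longlonglongrightarrow> 0"
  proof (rule Lim_null_comparison)
    show "\<forall>\<^sub>F n in sequentially. norm (x n \<bullet> (b n - c)) \<le> C * norm (b n - c)"
    proof (rule always_eventually, rule allI)
      fix n
      have "norm (x n \<bullet> (b n - c)) \<le> norm (x n) * norm (b n - c)"
        using Cauchy_Schwarz_ineq2 by simp
      also have "\<dots> \<le> C * norm (b n - c)" using bd by (intro mult_right_mono) auto
      finally show "norm (x n \<bullet> (b n - c)) \<le> C * norm (b n - c)" .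
    qed
    have "(\<lambda>n. C * norm (b n - c)) \<longlonglongrightarrow> C * norm (c - c)" by (intro tendsto_intros b)
    then show "(\<lambda>n. C * norm (b n - c)) \<longlonglongrightarrow> 0" by simp
  qed
  moreover have "(\<lambda>n. x n \<bullet> c) \<longlonglongrightarrow> l \<bullet> c"
    using assms(2) unfolding weakly_tendsto_def by blast
  ultimately have "(\<lambda>n. x n \<bullet> (b n - c) + x n \<bullet> c) \<longlonglongrightarrow> 0 + l \<bullet> c" by (rule tendsto_add)
  then show ?thesis by (simp add: inner_diff_right)
qed

text \<open>
  If some inner product stayed away from its limit along a subsequence, weak compactness would give a
  second cluster point.
\<close>

lemma weakly_tendsto_of_unique_cluster:
  fixes x :: "nat \<Rightarrow> 'h::{real_inner, banach, second_countable_topology}"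
  assumes bd: "\<And>n. norm (x n) \<le> C"
    and cl: "\<And>s y. strict_mono s \<Longrightarrow> weakly_tendsto (x \<circ> s) y \<Longrightarrow> y = l"
  shows "weakly_tendsto x l"
  unfolding weakly_tendsto_def
proof (rule allI, rule ccontr)
  fix h
  assume "\<not> (\<lambda>n. x n \<bullet> h) \<longlonglongrightarrow> l \<bullet> h"
  then obtain e where e: "e > 0" "\<not> (\<forall>\<^sub>F n in sequentially. dist (x n \<bullet> h) (l \<bullet> h) < e)"
    unfolding tendsto_iff by blast
  then have "infinite {n. \<not> dist (x n \<bullet> h) (l \<bullet> h) < e}"
    unfolding eventually_sequentially infinite_nat_iff_unbounded_le by blast
  from infinite_enumerate[OF this] obtain s :: "nat \<Rightarrow> nat"
    where s: "strict_mono s" "\<And>n. \<not> dist (x (s n) \<bullet> h) (l \<bullet> h) < e" by blast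
  have "norm ((x \<circ> s) n) \<le> C" for n using bd by simp
  then obtain t y where t: "strict_mono t" "weakly_tendsto (x \<circ> s \<circ> t) y"
    by (rule weak_sequential_compactness)
  then have "weakly_tendsto (x \<circ> (s \<circ> t)) l"
    using cl[of "s \<circ> t" y] s(1) by (simp add: o_assoc strict_mono_o)
  then have "(\<lambda>n. x (s (t n)) \<bullet> h) \<longlonglongrightarrow> l \<bullet> h" unfolding weakly_tendsto_def by simp
  from tendstoD[OF this e(1)] have "\<forall>\<^sub>F n in sequentially. False"
    using s(2) by simp
  then show False by simp
qed

text \<open>
  Pettis' theorem in a separable inner product space: a closed ball is the intersection of countably
  many half-spaces, since \<open>\<parallel>v\<parallel> \<le> q\<close> can be tested on inner products with a dense set, and every
  open set is a countable union of closed balls.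
\<close>

lemma borel_measurable_weak_limit:
  fixes y :: "'o \<Rightarrow> 'h::{real_inner, second_countable_topology}"
  assumes meas: "\<And>h. (\<lambda>\<omega>. y \<omega> \<bullet> h) \<in> borel_measurable M"
  shows "y \<in> borel_measurable M"
proof (rule borel_measurableI)
  obtain D :: "'h set" where D: "countable D" "UNIV \<subseteq> closure D"
    using separable[of UNIV] by metis
  have ball: "norm v \<le> q \<longleftrightarrow> q \<ge> 0 \<and> (\<forall>d\<in>D. v \<bullet> d \<le> q * norm d)" for v :: 'h and q
  proof
    assume *: "norm v \<le> q"
    have "v \<bullet> d \<le> q * norm d" for d
      using norm_cauchy_schwarz[of v d] mult_right_mono[OF *, of "norm d"] by simp
    then show "q \<ge> 0 \<and> (\<forall>d\<in>D. v \<bullet> d \<le> q * norm d)" using * norm_ge_zero order_trans by blast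
  next
    assume *: "q \<ge> 0 \<and> (\<forall>d\<in>D. v \<bullet> d \<le> q * norm d)"
    have "closed {d. v \<bullet> d \<le> q * norm d}"
      by (intro closed_Collect_le continuous_intros)
    then have "closure D \<subseteq> {d. v \<bullet> d \<le> q * norm d}" using * by (intro closure_minimal) auto
    then have "v \<bullet> v \<le> q * norm v" using D(2) by blast
    then show "norm v \<le> q"
      using * by (cases "v = 0") (auto simp: power2_norm_eq_inner[symmetric] power2_eq_square)
  qed
  have cball: "y -` cball a q \<inter> space M \<in> sets M" for a q
  proof -
    have "y -` cball a q \<inter> space M
      = {\<omega> \<in> space M. q \<ge> 0 \<and> (\<forall>d\<in>D. y \<omega> \<bullet> d - a \<bullet> d \<le> q * norm d)}"
      by (auto simp: ball dist_norm norm_minus_commute[of a] inner_diff_left)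
    also have "\<dots> \<in> sets M" using D(1) meas by measurable
    finally show ?thesis .
  qed
  fix S :: "'h set" assume "open S"
  define I where "I = {(d, q). d \<in> D \<and> q \<in> \<rat> \<and> cball d q \<subseteq> S}"
  have "I \<subseteq> D \<times> \<rat>" unfolding I_def by auto
  then have "countable I" using D(1) countable_rat by (meson countable_SIGMA countable_subset)
  have "S \<subseteq> (\<Union>(d, q)\<in>I. cball d q)"
  proof
    fix v assume "v \<in> S"
    then obtain e where e: "e > 0" "ball v e \<subseteq> S" using \<open>open S\<close> openE by blast
    obtain q where q: "q \<in> \<rat>" "0 < q" "q < e / 2" using Rats_dense_in_real[of 0 "e/2"] e(1) by auto
    obtain d where d: "d \<in> D" "dist d v < q" using D(2) q(2) closure_approachable by blast
    have "cball d q \<subseteq> S"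
    proof
      fix u assume "u \<in> cball d q"
      then have "dist v u < e" using d(2) q(3) dist_triangle[of v u d]
        by (simp add: dist_commute)
      then show "u \<in> S" using e(2) by auto
    qed
    then have "(d, q) \<in> I" using d q unfolding I_def by auto
    moreover have "v \<in> cball d q" using d by simp
    ultimately show "v \<in> (\<Union>(d, q)\<in>I. cball d q)" by blast
  qed
  then have "S = (\<Union>(d, q)\<in>I. cball d q)" unfolding I_def by blast
  then have "y -` S \<inter> space M = (\<Union>i\<in>I. y -` cball (fst i) (snd i) \<inter> space M)"
    by (auto simp: case_prod_unfold)
  also have "\<dots> \<in> sets M" using \<open>countable I\<close> cball by (intro sets.countable_UN') auto
  finally show "y -` S \<inter> space M \<in> sets M" .
qed

section \<open>Almost sure convergence of nonnegative supermartingales\<close>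

text \<open>
  The trading strategy behind Doob's upcrossing inequality: buy one unit as soon as the price \<open>X\<close> is
  below \<open>a\<close>, sell it as soon as the price exceeds \<open>b\<close>.  Whether the unit is held during
  the step from \<open>n\<close> to \<open>n + 1\<close> depends on the prices up to time \<open>n\<close> only.
\<close>

primrec holding :: "real \<Rightarrow> real \<Rightarrow> (nat \<Rightarrow> real) \<Rightarrow> nat \<Rightarrow> bool" where
  "holding a b X 0 \<longleftrightarrow> X 0 < a"
| "holding a b X (Suc n) \<longleftrightarrow> (if holding a b X n then X (Suc n) \<le> b else X (Suc n) < a)"

definition sells :: "real \<Rightarrow> real \<Rightarrow> (nat \<Rightarrow> real) \<Rightarrow> nat \<Rightarrow> bool" where
  "sells a b X n \<longleftrightarrow> holding a b X n \<and> \<not> holding a b X (Suc n)"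

text \<open>
  Every completed purchase and sale earns at least \<open>b - a\<close>.  The extra summand accounts for a unit that is
  still held, bought at a price below \<open>a\<close>; it makes the statement inductive.
\<close>

lemma sales_le_gain:
  assumes "a < b"
  shows "(b - a) * (\<Sum>k<n. of_bool (sells a b X k)) + (if holding a b X n then X n - a else 0)
    \<le> (\<Sum>k<n. of_bool (holding a b X k) * (X (Suc k) - X k))"
proof (induction n)
  case 0
  then show ?case by simp
next
  case (Suc n)
  then show ?case using assms
    by (cases "holding a b X n"; cases "holding a b X (Suc n)")
       (auto simp: sells_def distrib_left)
qed

text \<open>
  Once the price has been below \<open>a\<close> after the last sale, the unit is held forever, so the price never
  exceeds \<open>b\<close> again.
\<close>

lemma finitely_many_sales_imp_no_oscillation:
  assumes "a < b" and no_sale: "\<And>k. k \<ge> N \<Longrightarrow> \<not> sells a b X k"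
  shows "\<not> ((\<exists>\<^sub>F n in sequentially. X n < a) \<and> (\<exists>\<^sub>F n in sequentially. b < X n))"
proof
  assume osc: "(\<exists>\<^sub>F n in sequentially. X n < a) \<and> (\<exists>\<^sub>F n in sequentially. b < X n)"
  then obtain n where n: "n \<ge> N" "X n < a" unfolding frequently_sequentially by blast
  have "holding a b X m" if "m \<ge> n" for m
    using that
  proof (induction m rule: dec_induct)
    case base
    show ?case using n \<open>a < b\<close> by (cases n) auto
  next
    case (step m)
    then show ?case using no_sale[of m] n(1) by (simp add: sells_def)
  qed
  moreover have "holding a b X m \<Longrightarrow> X m \<le> b" for m
    using \<open>a < b\<close> by (cases m) (auto split: if_splits)
  moreover obtain m where "m \<ge> n" "b < X m"
    using osc unfolding frequently_sequentially by blast
  ultimately show False by force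
qed

text \<open>
  Only rational levels occur, so that countably many null sets suffice when this is applied to almost
  every path.  Levels \<open>a \<le> 0\<close> are excluded because a nonnegative sequence cannot go below them; the
  bound \<open>c\<close> rules out divergence to infinity.
\<close>

lemma convergent_of_no_oscillation:
  fixes X :: "nat \<Rightarrow> real"
  assumes nonneg: "\<And>n. 0 \<le> X n"
    and freq: "\<exists>\<^sub>F n in sequentially. X n < c"
    and no_osc: "\<And>a b. a \<in> \<rat> \<Longrightarrow> b \<in> \<rat> \<Longrightarrow> 0 < a \<Longrightarrow> a < b \<Longrightarrow>
      \<not> ((\<exists>\<^sub>F n in sequentially. X n < a) \<and> (\<exists>\<^sub>F n in sequentially. b < X n))"
  shows "convergent X"
proof -
  obtain a where a: "a \<in> \<rat>" "max 0 c < a" "a < max 0 c + 1"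
    using Rats_dense_in_real[of "max 0 c" "max 0 c + 1"] by auto
  have "\<exists>\<^sub>F n in sequentially. X n < a"
    using freq by (rule frequently_elim1) (use a(2) in auto)
  then have "\<not> (\<exists>\<^sub>F n in sequentially. a + 1 < X n)"
    using no_osc[of a "a + 1"] a by auto
  then obtain N where N: "\<And>n. n \<ge> N \<Longrightarrow> X n \<le> a + 1"
    unfolding not_frequently eventually_sequentially by (auto simp: not_less)
  have "bounded (range (\<lambda>n. X (n + N)))"
    by (rule boundedI[of _ "a + 1"]) (use N nonneg in auto)
  then obtain l r where r: "strict_mono r" "((\<lambda>n. X (n + N)) \<circ> r) \<longlonglongrightarrow> l"
    using bounded_imp_convergent_subsequence by blast
  have near: "\<exists>\<^sub>F n in sequentially. \<bar>X n - l\<bar> < e" if "e > 0" for e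
    unfolding frequently_sequentially
  proof
    fix m
    obtain k where k: "\<And>i. i \<ge> k \<Longrightarrow> dist (X (r i + N)) l < e"
      using metric_LIMSEQ_D[OF r(2) \<open>e > 0\<close>] by (auto simp: o_def)
    have "r (max k m) + N \<ge> m" using seq_suble[OF r(1), of "max k m"] by simp
    with k[of "max k m"] show "\<exists>n\<ge>m. \<bar>X n - l\<bar> < e" by (auto simp: dist_real_def)
  qed
  have "X \<longlonglongrightarrow> l"
  proof (rule ccontr)
    assume "\<not> X \<longlonglongrightarrow> l"
    then obtain e where e: "e > 0" "\<exists>\<^sub>F n in sequentially. \<not> dist (X n) l < e"
      unfolding tendsto_iff frequently_def by auto
    have "\<exists>\<^sub>F n in sequentially. l + e \<le> X n \<or> X n \<le> l - e"
      using e(2) by (rule frequently_elim1) (auto simp: dist_real_def)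
    then consider (above) "\<exists>\<^sub>F n in sequentially. l + e \<le> X n"
      | (below) "\<exists>\<^sub>F n in sequentially. X n \<le> l - e"
      unfolding frequently_disj_iff by blast
    then show False
    proof cases
      case above
      have "l \<ge> 0" using r(2) by (rule LIMSEQ_le_const) (use nonneg in auto)
      obtain b where b: "b \<in> \<rat>" "l < b" "b < l + e"
        using Rats_dense_in_real[of l "l + e"] e(1) by auto
      obtain a where a: "a \<in> \<rat>" "l < a" "a < b"
        using Rats_dense_in_real[of l b] b by auto
      have "\<exists>\<^sub>F n in sequentially. X n < a"
        by (rule frequently_elim1[OF near[of "a - l"]]) (use a in auto)
      moreover have "\<exists>\<^sub>F n in sequentially. b < X n"
        using above by (rule frequently_elim1) (use b in auto)
      ultimately show False using no_osc[of a b] a b \<open>l \<ge> 0\<close> by auto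
    next
      case below
      then obtain n where "X n \<le> l - e" using frequently_ex by blast
      then have "0 \<le> l - e" using nonneg[of n] by linarith
      obtain b where b: "b \<in> \<rat>" "l - e < b" "b < l"
        using Rats_dense_in_real[of "l - e" l] e(1) by auto
      obtain a where a: "a \<in> \<rat>" "l - e < a" "a < b"
        using Rats_dense_in_real[of "l - e" b] b by auto
      have "\<exists>\<^sub>F n in sequentially. X n < a"
        using below by (rule frequently_elim1) (use a in auto)
      moreover have "\<exists>\<^sub>F n in sequentially. b < X n"
        by (rule frequently_elim1[OF near[of "l - b"]]) (use b in auto)
      ultimately show False using no_osc[of a b] a b \<open>0 \<le> l - e\<close> by auto
    qed
  qed
  then show ?thesis by (auto simp: convergent_def)
qed

lemma AE_summable_of_bounded_integrals:
  fixes f :: "nat \<Rightarrow> 'o \<Rightarrow> real"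
  assumes int: "\<And>k. integrable M (f k)"
    and nonneg: "\<And>k \<omega>. \<omega> \<in> space M \<Longrightarrow> 0 \<le> f k \<omega>"
    and bound: "\<And>n. (\<Sum>k<n. \<integral>\<omega>. f k \<omega> \<partial>M) \<le> C"
  shows "AE \<omega> in M. summable (\<lambda>k. f k \<omega>)"
proof -
  have [measurable]: "f k \<in> borel_measurable M" for k using int by simp
  have nn: "0 \<le> (\<integral>\<omega>. f k \<omega> \<partial>M)" for k using nonneg by (intro integral_nonneg_AE) auto
  have "(\<integral>\<^sup>+\<omega>. (\<Sum>k. ennreal (f k \<omega>)) \<partial>M) = (\<Sum>k. \<integral>\<^sup>+\<omega>. ennreal (f k \<omega>) \<partial>M)"
    by (rule nn_integral_suminf) measurable
  also have "\<dots> = (\<Sum>k. ennreal (\<integral>\<omega>. f k \<omega> \<partial>M))"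
    using nonneg by (intro arg_cong[where f = suminf] ext nn_integral_eq_integral int) auto
  also have "\<dots> \<noteq> \<top>"
    using summableI_nonneg_bounded[OF nn bound] nn by (intro ennreal_suminf_neq_top)
  finally have "AE \<omega> in M. (\<Sum>k. ennreal (f k \<omega>)) \<noteq> \<infinity>"
    by (intro nn_integral_PInf_AE) auto
  then show ?thesis
    using AE_space
  proof eventually_elim
    case (elim \<omega>)
    then show ?case using nonneg by (intro summable_suminf_not_top) auto
  qed
qed

locale filtered_prob_space = prob_space M for M :: "'o measure" +
  fixes F :: "nat \<Rightarrow> 'o measure"
  assumes subalg: "\<And>n. subalgebra M (F n)"
    and F_Suc: "\<And>n. sets (F n) \<subseteq> sets (F (Suc n))"
begin

lemma space_F [simp]: "space (F n) = space M"
  using subalg[of n] by (simp add: subalgebra_def)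

lemma sets_F: "D \<in> sets (F n) \<Longrightarrow> D \<in> sets M"
  using subalg[of n] by (auto simp: subalgebra_def)

lemma measurable_F_mono:
  assumes "m \<le> n" "f \<in> measurable (F m) N"
  shows "f \<in> measurable (F n) N"
proof -
  have "sets (F m) \<subseteq> sets (F n)" using lift_Suc_mono_le[of "\<lambda>n. sets (F n)"] F_Suc assms(1) by blast
  then have "subalgebra (F n) (F m)" by (simp add: subalgebra_def)
  then show ?thesis using assms(2) measurable_from_subalg by blast
qed

text \<open>
  The supermartingale property is stated through integrals over events of the past, which avoids
  conditional expectations.  The strategy \<open>holding\<close> is predictable, so its expected gain is at most \<open>0\<close>;
  hence the expected number of sales is at most \<open>a / (b - a)\<close> and almost no path oscillates
  between \<open>a\<close> and \<open>b\<close>.  Fatou's lemma shows that the limit inferior is finite almost surely.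
\<close>

theorem nonneg_supermartingale_converges:
  fixes X :: "nat \<Rightarrow> 'o \<Rightarrow> real"
  assumes adapted: "\<And>n. X n \<in> borel_measurable (F n)"
    and int: "\<And>n. integrable M (X n)"
    and nonneg: "\<And>n \<omega>. \<omega> \<in> space M \<Longrightarrow> 0 \<le> X n \<omega>"
    and super: "\<And>n D. D \<in> sets (F n) \<Longrightarrow> (\<integral>\<omega>. indicator D \<omega> * (X (Suc n) \<omega> - X n \<omega>) \<partial>M) \<le> 0"
  shows "AE \<omega> in M. convergent (\<lambda>n. X n \<omega>)"
proof -
  have no_osc: "AE \<omega> in M. \<not> ((\<exists>\<^sub>F n in sequentially. X n \<omega> < a) \<and> (\<exists>\<^sub>F n in sequentially. b < X n \<omega>))"
    if "0 < a" "a < b" for a b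
  proof -
    define H where "H k = {\<omega> \<in> space M. holding a b (\<lambda>n. X n \<omega>) k}" for k
    have H: "H k \<in> sets (F k)" for k
    proof (induction k)
      case 0
      have "H 0 = {\<omega> \<in> space (F 0). X 0 \<omega> < a}" by (simp add: H_def)
      also have "\<dots> \<in> sets (F 0)" using adapted by measurable
      finally show ?case .
    next
      case (Suc k)
      have [measurable]: "H k \<in> sets (F (Suc k))" using Suc F_Suc by blast
      have [measurable]: "X (Suc k) \<in> borel_measurable (F (Suc k))" by (rule adapted)
      have "H (Suc k) = {\<omega> \<in> space (F (Suc k)). if \<omega> \<in> H k then X (Suc k) \<omega> \<le> b else X (Suc k) \<omega> < a}"
        by (auto simp: H_def)
      also have "\<dots> \<in> sets (F (Suc k))" by measurable
      finally show ?case .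
    qed
    have HM [measurable]: "H k \<in> sets M" for k using H sets_F by blast
    define s where "s k = indicat_real (H k - H (Suc k))" for k
    have s_sells: "s k \<omega> = of_bool (sells a b (\<lambda>n. X n \<omega>) k)" if "\<omega> \<in> space M" for k \<omega>
      using that by (auto simp: s_def H_def sells_def indicator_def)
    have s_int: "integrable M (s k)" for k
      unfolding s_def by (intro integrable_real_indicator) (auto simp: less_top[symmetric])
    define g where "g k \<omega> = indicator (H k) \<omega> * (X (Suc k) \<omega> - X k \<omega>)" for k \<omega>
    have g_int: "integrable M (g k)" for k
      unfolding g_def
      using integrable_real_mult_indicator[OF HM Bochner_Integration.integrable_diff[OF int int]]
      by (simp add: mult.commute)
    have "(\<Sum>k<n. \<integral>\<omega>. s k \<omega> \<partial>M) \<le> a / (b - a)" for n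
    proof -
      have "(b - a) * (\<Sum>k<n. \<integral>\<omega>. s k \<omega> \<partial>M) = (\<integral>\<omega>. (b - a) * (\<Sum>k<n. s k \<omega>) \<partial>M)"
        using s_int by (simp add: Bochner_Integration.integral_sum)
      also have "\<dots> \<le> (\<integral>\<omega>. a + (\<Sum>k<n. g k \<omega>) \<partial>M)"
      proof (rule integral_mono)
        fix \<omega> assume \<omega>: "\<omega> \<in> space M"
        have "- a \<le> (if holding a b (\<lambda>n. X n \<omega>) n then X n \<omega> - a else 0)"
          using nonneg[OF \<omega>, of n] \<open>0 < a\<close> by simp
        with sales_le_gain[OF \<open>a < b\<close>, of "\<lambda>n. X n \<omega>" n]
        have "(b - a) * (\<Sum>k<n. of_bool (sells a b (\<lambda>n. X n \<omega>) k))
          \<le> a + (\<Sum>k<n. of_bool (holding a b (\<lambda>n. X n \<omega>) k) * (X (Suc k) \<omega> - X k \<omega>))"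
          by linarith
        moreover have "indicator (H k) \<omega> = (of_bool (holding a b (\<lambda>n. X n \<omega>) k) :: real)" for k
          using \<omega> by (simp add: H_def indicator_def)
        ultimately show "(b - a) * (\<Sum>k<n. s k \<omega>)
            \<le> a + (\<Sum>k<n. g k \<omega>)"
          using s_sells[OF \<omega>] by (simp add: g_def)
      qed (intro integrable_mult_right Bochner_Integration.integrable_add integrable_const
             Bochner_Integration.integrable_sum s_int g_int)+
      also have "\<dots> = a + (\<Sum>k<n. \<integral>\<omega>. g k \<omega> \<partial>M)"
        using g_int by (simp add: Bochner_Integration.integral_sum Bochner_Integration.integrable_sum prob_space)
      also have "\<dots> \<le> a" using super[OF H] by (simp add: g_def sum_nonpos)
      finally show ?thesis using \<open>a < b\<close> by (simp add: field_simps)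
    qed
    from AE_summable_of_bounded_integrals[OF s_int _ this]
    have "AE \<omega> in M. summable (\<lambda>k. s k \<omega>)" by (simp add: s_def)
    then show ?thesis
      using AE_space
    proof eventually_elim
      case (elim \<omega>)
      from LIMSEQ_D[OF summable_LIMSEQ_zero[OF elim(1)], of 1]
      obtain N where "\<And>k. k \<ge> N \<Longrightarrow> norm (s k \<omega>) < 1" by auto
      then have "\<not> sells a b (\<lambda>n. X n \<omega>) k" if "k \<ge> N" for k
        using s_sells[OF elim(2)] that by fastforce
      then show ?case by (rule finitely_many_sales_imp_no_oscillation[OF \<open>a < b\<close>])
    qed
  qed
  have "AE \<omega> in M. \<forall>a\<in>\<rat>. \<forall>b\<in>\<rat>. 0 < a \<longrightarrow> a < b \<longrightarrow>
    \<not> ((\<exists>\<^sub>F n in sequentially. X n \<omega> < a) \<and> (\<exists>\<^sub>F n in sequentially. b < X n \<omega>))"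
    using no_osc by (intro AE_ball_countable' countable_rat AE_impI)
  moreover have "AE \<omega> in M. liminf (\<lambda>n. ennreal (X n \<omega>)) \<noteq> \<infinity>"
  proof (rule nn_integral_PInf_AE)
    have [measurable]: "X n \<in> borel_measurable M" for n using int by simp
    show "(\<lambda>\<omega>. liminf (\<lambda>n. ennreal (X n \<omega>))) \<in> borel_measurable M" by measurable
    have decr: "(\<integral>\<omega>. X n \<omega> \<partial>M) \<le> (\<integral>\<omega>. X 0 \<omega> \<partial>M)" for n
    proof (induction n)
      case (Suc n)
      have "(\<integral>\<omega>. indicator (space M) \<omega> * (X (Suc n) \<omega> - X n \<omega>) \<partial>M) = (\<integral>\<omega>. X (Suc n) \<omega> - X n \<omega> \<partial>M)"
        by (intro Bochner_Integration.integral_cong) auto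
      then have "(\<integral>\<omega>. X (Suc n) \<omega> \<partial>M) \<le> (\<integral>\<omega>. X n \<omega> \<partial>M)"
        using super[of "space M" n] sets.top[of "F n"] int by simp
      with Suc show ?case by simp
    qed simp
    have "(\<integral>\<^sup>+\<omega>. liminf (\<lambda>n. ennreal (X n \<omega>)) \<partial>M) \<le> liminf (\<lambda>n. \<integral>\<^sup>+\<omega>. ennreal (X n \<omega>) \<partial>M)"
      by (rule nn_integral_liminf) measurable
    also have "(\<lambda>n. \<integral>\<^sup>+\<omega>. ennreal (X n \<omega>) \<partial>M) = (\<lambda>n. ennreal (\<integral>\<omega>. X n \<omega> \<partial>M))"
      using nonneg by (intro ext nn_integral_eq_integral int) auto
    also have "liminf \<dots> \<le> liminf (\<lambda>n. ennreal (\<integral>\<omega>. X 0 \<omega> \<partial>M))"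
      by (intro Liminf_mono always_eventually) (auto intro!: ennreal_leI decr)
    also have "\<dots> = ennreal (\<integral>\<omega>. X 0 \<omega> \<partial>M)" by (simp add: Liminf_const)
    finally have "(\<integral>\<^sup>+\<omega>. liminf (\<lambda>n. ennreal (X n \<omega>)) \<partial>M) \<le> ennreal (\<integral>\<omega>. X 0 \<omega> \<partial>M)" .
    then show "(\<integral>\<^sup>+\<omega>. liminf (\<lambda>n. ennreal (X n \<omega>)) \<partial>M) \<noteq> \<infinity>"
      using neq_top_trans[OF ennreal_neq_top] by (simp add: infinity_ennreal_def)
  qed
  ultimately show ?thesis
    using AE_space
  proof eventually_elim
    case (elim \<omega>)
    then obtain m where m: "liminf (\<lambda>n. ennreal (X n \<omega>)) < of_nat m"
      using ennreal_Ex_less_of_nat[of "liminf (\<lambda>n. ennreal (X n \<omega>))"] by (auto simp: less_top)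
    have "\<exists>\<^sub>F n in sequentially. X n \<omega> < real m"
    proof (rule ccontr)
      assume "\<not> ?thesis"
      then have "\<forall>\<^sub>F n in sequentially. of_nat m \<le> ennreal (X n \<omega>)"
        unfolding not_frequently
        by (rule eventually_mono) (auto simp: ennreal_of_nat_eq_real_of_nat not_less intro!: ennreal_leI)
      then have "of_nat m \<le> liminf (\<lambda>n. ennreal (X n \<omega>))" by (rule Liminf_bounded)
      with m show False by simp
    qed
    then show ?case
      using elim nonneg by (intro convergent_of_no_oscillation[where c = "real m"]) auto
  qed
qed

text \<open>
  Without the perturbation \<open>\<eta>\<close>, the process \<open>X\<close> would be a supermartingale.  Subtracting the sums of
  \<open>\<eta>\<close> restores the supermartingale property but destroys nonnegativity; stopping just before these sums
  exceed a level \<open>N\<close> and adding \<open>N\<close> restores both.  The decrease of the expectations of the stopped process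
  bounds the sum of the integrals of \<open>\<Theta>\<close> over the running events.  Almost every path is never stopped
  for \<open>N\<close> large enough.
\<close>

lemma robbins_siegmund_unscaled:
  fixes X \<Theta> \<eta> :: "nat \<Rightarrow> 'o \<Rightarrow> real"
  assumes X: "\<And>n. X n \<in> borel_measurable (F n)" "\<And>n. integrable M (X n)"
      "\<And>n \<omega>. \<omega> \<in> space M \<Longrightarrow> 0 \<le> X n \<omega>"
    and \<Theta>: "\<And>n. integrable M (\<Theta> n)" "\<And>n \<omega>. \<omega> \<in> space M \<Longrightarrow> 0 \<le> \<Theta> n \<omega>"
    and \<eta>: "\<And>n. \<eta> n \<in> borel_measurable (F n)" "\<And>n. integrable M (\<eta> n)"
      "\<And>n \<omega>. \<omega> \<in> space M \<Longrightarrow> 0 \<le> \<eta> n \<omega>"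
    and ineq: "\<And>n D. D \<in> sets (F n) \<Longrightarrow>
      (\<integral>\<omega>. indicator D \<omega> * (X (Suc n) \<omega> - X n \<omega> + \<Theta> n \<omega> - \<eta> n \<omega>) \<partial>M) \<le> 0"
    and sum_\<eta>: "AE \<omega> in M. summable (\<lambda>n. \<eta> n \<omega>)"
  shows "AE \<omega> in M. convergent (\<lambda>n. X n \<omega>) \<and> summable (\<lambda>n. \<Theta> n \<omega>)"
proof -
  \<comment> \<open>\<open>G N n\<close> is the event that the process is still running during the step from \<open>n\<close> to \<open>n + 1\<close>.\<close>
  define G where "G N n = {\<omega> \<in> space M. (\<Sum>k<Suc n. \<eta> k \<omega>) \<le> N}" for N n
  have G_F: "G N n \<in> sets (F n)" for N n
  proof -
    have [measurable]: "\<eta> k \<in> borel_measurable (F n)" if "k \<in> {..<Suc n}" for k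
      using measurable_F_mono[OF _ \<eta>(1)] that by simp
    have "(\<lambda>\<omega>. \<Sum>k<Suc n. \<eta> k \<omega>) \<in> borel_measurable (F n)"
      by (rule borel_measurable_sum) measurable
    then have "{\<omega> \<in> space (F n). (\<Sum>k<Suc n. \<eta> k \<omega>) \<le> N} \<in> sets (F n)" by measurable
    then show ?thesis by (simp add: G_def)
  qed
  have G_M [measurable]: "G N n \<in> sets M" for N n using G_F sets_F by blast
  have ind: "integrable M (\<lambda>\<omega>. indicator D \<omega> * f \<omega>)" if "integrable M f" "D \<in> sets M" for f :: "'o \<Rightarrow> real" and D
    using integrable_real_mult_indicator[OF that(2,1)] by (simp add: mult.commute)
  have stopped: "AE \<omega> in M. convergent (\<lambda>n. \<Sum>k<n. indicator (G N k) \<omega> * (X (Suc k) \<omega> - X k \<omega> - \<eta> k \<omega>)) \<and>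
      summable (\<lambda>n. indicator (G N n) \<omega> * \<Theta> n \<omega>)" if "0 \<le> N" for N :: real
  proof -
    define d where "d k \<omega> = indicator (G N k) \<omega> * (X (Suc k) \<omega> - X k \<omega> - \<eta> k \<omega>)" for k \<omega>
    define T where "T n \<omega> = N + X 0 \<omega> + (\<Sum>k<n. d k \<omega>)" for n \<omega>
    have d_int: "integrable M (d k)" for k unfolding d_def by (intro ind X \<eta> Bochner_Integration.integrable_diff G_M)
    have T_int: "integrable M (T n)" for n
      unfolding T_def by (intro Bochner_Integration.integrable_add Bochner_Integration.integrable_sum X d_int) auto
    have T_adapted: "T n \<in> borel_measurable (F n)" for n
    proof -
      have "d k \<in> borel_measurable (F n)" if "k < n" for k
      proof -
        have "X (Suc k) \<in> borel_measurable (F n)" "X k \<in> borel_measurable (F n)"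
          "\<eta> k \<in> borel_measurable (F n)"
          using measurable_F_mono[OF _ X(1)] measurable_F_mono[OF _ \<eta>(1)] that by auto
        moreover have "indicat_real (G N k) \<in> borel_measurable (F n)"
          using measurable_F_mono[OF _ borel_measurable_indicator[OF G_F[of N k]], of n] that by simp
        ultimately show ?thesis
          unfolding d_def by (intro borel_measurable_times borel_measurable_diff)
      qed
      moreover have "X 0 \<in> borel_measurable (F n)" using measurable_F_mono[OF _ X(1)] by simp
      ultimately show ?thesis unfolding T_def
        by (intro borel_measurable_add borel_measurable_sum borel_measurable_const) auto
    qed
    have T_nonneg: "0 \<le> T n \<omega>" if \<omega>: "\<omega> \<in> space M" for n \<omega>
    proof -
      have "0 \<le> T n \<omega> \<and> ((\<forall>k<n. \<omega> \<in> G N k) \<longrightarrow> T n \<omega> = N + X n \<omega> - (\<Sum>k<n. \<eta> k \<omega>))"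
      proof (induction n)
        case 0
        then show ?case using X(3)[OF \<omega>] \<open>0 \<le> N\<close> by (simp add: T_def)
      next
        case (Suc n)
        show ?case
        proof (cases "\<omega> \<in> G N n")
          case True
          have "\<omega> \<in> G N k" if "k < n" for k
          proof -
            have "(\<Sum>i<Suc k. \<eta> i \<omega>) \<le> (\<Sum>i<Suc n. \<eta> i \<omega>)"
              using that \<eta>(3)[OF \<omega>] by (intro sum_mono2) auto
            then show ?thesis using True unfolding G_def by auto
          qed
          with Suc have "T n \<omega> = N + X n \<omega> - (\<Sum>k<n. \<eta> k \<omega>)" by blast
          then have "T (Suc n) \<omega> = N + X (Suc n) \<omega> - (\<Sum>k<Suc n. \<eta> k \<omega>)"
            using True by (simp add: T_def d_def)
          moreover have "(\<Sum>k<Suc n. \<eta> k \<omega>) \<le> N" using True by (simp add: G_def)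
          ultimately show ?thesis using X(3)[OF \<omega>, of "Suc n"] by simp
        next
          case False
          then have "T (Suc n) \<omega> = T n \<omega>" by (simp add: T_def d_def)
          then show ?thesis using Suc False by auto
        qed
      qed
      then show ?thesis by blast
    qed
    have step: "(\<integral>\<omega>. indicator D \<omega> * (T (Suc n) \<omega> - T n \<omega>) \<partial>M) \<le> - (\<integral>\<omega>. indicator D \<omega> * (indicator (G N n) \<omega> * \<Theta> n \<omega>) \<partial>M)"
      if D: "D \<in> sets (F n)" for n D
    proof -
      have "D \<inter> G N n \<in> sets (F n)" using D G_F by blast
      from ineq[OF this]
      have "0 \<ge> (\<integral>\<omega>. indicator (D \<inter> G N n) \<omega> * (X (Suc n) \<omega> - X n \<omega> + \<Theta> n \<omega> - \<eta> n \<omega>) \<partial>M)" .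
      also have "(\<integral>\<omega>. indicator (D \<inter> G N n) \<omega> * (X (Suc n) \<omega> - X n \<omega> + \<Theta> n \<omega> - \<eta> n \<omega>) \<partial>M)
        = (\<integral>\<omega>. indicator D \<omega> * (T (Suc n) \<omega> - T n \<omega>) + indicator D \<omega> * (indicator (G N n) \<omega> * \<Theta> n \<omega>) \<partial>M)"
        by (intro Bochner_Integration.integral_cong)
           (auto simp: T_def d_def indicator_inter_arith indicator_def algebra_simps)
      also have "\<dots> = (\<integral>\<omega>. indicator D \<omega> * (T (Suc n) \<omega> - T n \<omega>) \<partial>M)
          + (\<integral>\<omega>. indicator D \<omega> * (indicator (G N n) \<omega> * \<Theta> n \<omega>) \<partial>M)"
        using D sets_F by (intro Bochner_Integration.integral_add ind T_int \<Theta> Bochner_Integration.integrable_diff G_M) auto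
      finally show ?thesis by simp
    qed
    have "AE \<omega> in M. convergent (\<lambda>n. T n \<omega>)"
    proof (rule nonneg_supermartingale_converges[OF T_adapted T_int T_nonneg])
      fix n D assume D: "D \<in> sets (F n)"
      have "0 \<le> (\<integral>\<omega>. indicator D \<omega> * (indicator (G N n) \<omega> * \<Theta> n \<omega>) \<partial>M)"
        using \<Theta>(2) by (intro integral_nonneg_AE) auto
      with step[OF D] show "(\<integral>\<omega>. indicator D \<omega> * (T (Suc n) \<omega> - T n \<omega>) \<partial>M) \<le> 0" by linarith
    qed
    moreover have "AE \<omega> in M. summable (\<lambda>n. indicator (G N n) \<omega> * \<Theta> n \<omega>)"
    proof (rule AE_summable_of_bounded_integrals)
      have whole: "(\<integral>\<omega>. indicator (space M) \<omega> * f \<omega> \<partial>M) = (\<integral>\<omega>. f \<omega> \<partial>M)" for f :: "'o \<Rightarrow> real"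
        by (intro Bochner_Integration.integral_cong) auto
      have telescope: "(\<Sum>k<n. \<integral>\<omega>. indicator (G N k) \<omega> * \<Theta> k \<omega> \<partial>M) \<le> (\<integral>\<omega>. T 0 \<omega> \<partial>M) - (\<integral>\<omega>. T n \<omega> \<partial>M)" for n
      proof (induction n)
        case (Suc n)
        have "(\<integral>\<omega>. T (Suc n) \<omega> \<partial>M) - (\<integral>\<omega>. T n \<omega> \<partial>M) \<le> - (\<integral>\<omega>. indicator (G N n) \<omega> * \<Theta> n \<omega> \<partial>M)"
          using step[of "space M" n] sets.top[of "F n"] T_int by (simp add: whole)
        with Suc show ?case by simp
      qed simp
      have T_pos: "0 \<le> (\<integral>\<omega>. T n \<omega> \<partial>M)" for n using T_nonneg by (intro integral_nonneg_AE) auto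
      show "(\<Sum>k<n. \<integral>\<omega>. indicator (G N k) \<omega> * \<Theta> k \<omega> \<partial>M) \<le> (\<integral>\<omega>. T 0 \<omega> \<partial>M)" for n
        using telescope[of n] T_pos[of n] by linarith
    qed (use \<Theta> in \<open>auto intro!: ind\<close>)
    ultimately show ?thesis
    proof eventually_elim
      case (elim \<omega>)
      then have "convergent (\<lambda>n. T n \<omega> - (N + X 0 \<omega>))"
        by (intro convergent_diff convergent_const) auto
      then show ?case using elim(2) by (simp add: T_def d_def)
    qed
  qed
  have "AE \<omega> in M. \<forall>N::nat. convergent (\<lambda>n. \<Sum>k<n. indicator (G N k) \<omega> * (X (Suc k) \<omega> - X k \<omega> - \<eta> k \<omega>)) \<and>
      summable (\<lambda>n. indicator (G N n) \<omega> * \<Theta> n \<omega>)"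
    using stopped by (simp add: AE_all_countable)
  then show ?thesis
    using sum_\<eta> AE_space
  proof eventually_elim
    case (elim \<omega>)
    obtain N :: nat where N: "(\<Sum>n. \<eta> n \<omega>) \<le> N" using real_arch_simple by blast
    have in_G: "\<omega> \<in> G N k" for k
    proof -
      have "(\<Sum>i<Suc k. \<eta> i \<omega>) \<le> (\<Sum>n. \<eta> n \<omega>)"
        using elim(2) \<eta>(3)[OF elim(3)] by (intro sum_le_suminf) auto
      then show ?thesis using N elim(3) unfolding G_def by auto
    qed
    have conv: "convergent (\<lambda>n. \<Sum>k<n. X (Suc k) \<omega> - X k \<omega> - \<eta> k \<omega>)" and "summable (\<lambda>n. \<Theta> n \<omega>)"
      using elim(1)[rule_format, of N] in_G by auto
    moreover have "convergent (\<lambda>n. \<Sum>k<n. \<eta> k \<omega>)"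
      using elim(2) by (simp add: summable_iff_convergent)
    then have "convergent (\<lambda>n. (\<Sum>k<n. X (Suc k) \<omega> - X k \<omega> - \<eta> k \<omega>) + (\<Sum>k<n. \<eta> k \<omega>) + X 0 \<omega>)"
      using conv by (intro convergent_add convergent_const)
    moreover have "(\<Sum>k<n. X (Suc k) \<omega> - X k \<omega> - \<eta> k \<omega>) + (\<Sum>k<n. \<eta> k \<omega>) + X 0 \<omega> = X n \<omega>" for n
      by (induction n) auto
    ultimately show ?case by simp
  qed
qed

text \<open>
  Dividing by \<open>\<Prod>k<n. 1 + \<alpha>\<^sub>k\<close>, which converges and lies between \<open>1\<close> and \<open>exp (\<Sum>k. \<alpha>\<^sub>k)\<close>, removes
  the growth factors.
\<close>

theorem robbins_siegmund:
  fixes X \<Theta> \<eta> :: "nat \<Rightarrow> 'o \<Rightarrow> real" and \<alpha> :: "nat \<Rightarrow> real"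
  assumes X: "\<And>n. X n \<in> borel_measurable (F n)" "\<And>n. integrable M (X n)"
      "\<And>n \<omega>. \<omega> \<in> space M \<Longrightarrow> 0 \<le> X n \<omega>"
    and \<Theta>: "\<And>n. integrable M (\<Theta> n)" "\<And>n \<omega>. \<omega> \<in> space M \<Longrightarrow> 0 \<le> \<Theta> n \<omega>"
    and \<eta>: "\<And>n. \<eta> n \<in> borel_measurable (F n)" "\<And>n. integrable M (\<eta> n)"
      "\<And>n \<omega>. \<omega> \<in> space M \<Longrightarrow> 0 \<le> \<eta> n \<omega>"
    and \<alpha>: "\<And>n. 0 \<le> \<alpha> n" "summable \<alpha>"
    and ineq: "\<And>n D. D \<in> sets (F n) \<Longrightarrow>
      (\<integral>\<omega>. indicator D \<omega> * (X (Suc n) \<omega> - (1 + \<alpha> n) * X n \<omega> + \<Theta> n \<omega> - \<eta> n \<omega>) \<partial>M) \<le> 0"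
    and sum_\<eta>: "AE \<omega> in M. summable (\<lambda>n. \<eta> n \<omega>)"
  shows "AE \<omega> in M. convergent (\<lambda>n. X n \<omega>) \<and> summable (\<lambda>n. \<Theta> n \<omega>)"
proof -
  define c where "c n = (\<Prod>k<n. 1 + \<alpha> k)" for n
  have c_Suc: "c (Suc n) = c n * (1 + \<alpha> n)" for n by (simp add: c_def)
  have c_ge1: "1 \<le> c n" for n unfolding c_def by (intro prod_ge_1) (use \<alpha> in auto)
  then have c_pos: "0 < c n" for n using less_le_trans zero_less_one by blast
  have c_le: "c n \<le> exp (suminf \<alpha>)" for n
  proof -
    have "c n \<le> (\<Prod>k<n. exp (\<alpha> k))"
      unfolding c_def by (intro prod_mono) (use \<alpha>(1) exp_ge_add_one_self in auto)
    also have "\<dots> = exp (\<Sum>k<n. \<alpha> k)" by (simp add: exp_sum)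
    also have "\<dots> \<le> exp (suminf \<alpha>)" using \<alpha> by (simp add: sum_le_suminf)
    finally show ?thesis .
  qed
  have "incseq c"
    by (rule incseq_SucI)
       (use mult_left_mono[of 1 "1 + \<alpha> _" "c _"] c_pos \<alpha>(1) in \<open>simp add: c_Suc less_imp_le\<close>)
  then have c_conv: "convergent c"
    using c_le by (metis incseq_convergent convergent_def)
  have "AE \<omega> in M. convergent (\<lambda>n. X n \<omega> / c n) \<and> summable (\<lambda>n. \<Theta> n \<omega> / c (Suc n))"
  proof (rule robbins_siegmund_unscaled[where \<eta> = "\<lambda>n \<omega>. \<eta> n \<omega> / c (Suc n)"])
    fix n D assume "D \<in> sets (F n)"
    have "(\<integral>\<omega>. indicator D \<omega> * (X (Suc n) \<omega> / c (Suc n) - X n \<omega> / c n + \<Theta> n \<omega> / c (Suc n) - \<eta> n \<omega> / c (Suc n)) \<partial>M)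
      = (\<integral>\<omega>. (indicator D \<omega> * (X (Suc n) \<omega> - (1 + \<alpha> n) * X n \<omega> + \<Theta> n \<omega> - \<eta> n \<omega>)) / c (Suc n) \<partial>M)"
    proof (rule Bochner_Integration.integral_cong[OF refl])
      fix \<omega>
      have "X n \<omega> / c n = (1 + \<alpha> n) * X n \<omega> / c (Suc n)"
        using c_pos[of n] \<alpha>(1)[of n] by (simp add: c_Suc)
      then show "indicator D \<omega> * (X (Suc n) \<omega> / c (Suc n) - X n \<omega> / c n + \<Theta> n \<omega> / c (Suc n) - \<eta> n \<omega> / c (Suc n))
        = (indicator D \<omega> * (X (Suc n) \<omega> - (1 + \<alpha> n) * X n \<omega> + \<Theta> n \<omega> - \<eta> n \<omega>)) / c (Suc n)"
        by (simp only: times_divide_eq_right[symmetric] add_divide_distrib diff_divide_distrib)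
    qed
    also have "\<dots> = (\<integral>\<omega>. indicator D \<omega> * (X (Suc n) \<omega> - (1 + \<alpha> n) * X n \<omega> + \<Theta> n \<omega> - \<eta> n \<omega>) \<partial>M) / c (Suc n)"
      by (rule integral_divide_zero)
    also have "\<dots> \<le> 0" using ineq[OF \<open>D \<in> sets (F n)\<close>] c_pos[of "Suc n"] by (simp add: divide_nonpos_pos)
    finally show "(\<integral>\<omega>. indicator D \<omega> * (X (Suc n) \<omega> / c (Suc n) - X n \<omega> / c n + \<Theta> n \<omega> / c (Suc n) - \<eta> n \<omega> / c (Suc n)) \<partial>M) \<le> 0" .
  next
    show "AE \<omega> in M. summable (\<lambda>n. \<eta> n \<omega> / c (Suc n))"
      using sum_\<eta> AE_space
    proof eventually_elim
      case (elim \<omega>)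
      show ?case
      proof (rule summable_comparison_test'[OF elim(1), of 0])
        fix n
        have "\<eta> n \<omega> / c (Suc n) \<le> \<eta> n \<omega> / 1"
          using \<eta>(3)[OF elim(2)] c_ge1 by (intro divide_left_mono) (auto intro: c_pos)
        then show "norm (\<eta> n \<omega> / c (Suc n)) \<le> \<eta> n \<omega>"
          using \<eta>(3)[OF elim(2), of n] c_pos[of "Suc n"] by simp
      qed
    qed
  qed (use X \<Theta> \<eta> c_pos in \<open>auto simp: less_imp_le\<close>)
  then show ?thesis
    using AE_space
  proof eventually_elim
    case (elim \<omega>)
    have "convergent (\<lambda>n. X n \<omega> / c n * c n)" using elim c_conv by (intro convergent_mult) auto
    moreover have "X n \<omega> / c n * c n = X n \<omega>" for n using c_pos[of n] by simp
    moreover have "summable (\<lambda>n. \<Theta> n \<omega>)"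
    proof (rule summable_comparison_test'[of _ 0])
      show "summable (\<lambda>n. exp (suminf \<alpha>) * (\<Theta> n \<omega> / c (Suc n)))"
        using elim by (intro summable_mult) auto
      fix n
      have "\<Theta> n \<omega> = c (Suc n) * (\<Theta> n \<omega> / c (Suc n))" using c_pos[of "Suc n"] by simp
      also have "\<dots> \<le> exp (suminf \<alpha>) * (\<Theta> n \<omega> / c (Suc n))"
        using c_le[of "Suc n"] \<Theta>(2)[OF elim(2), of n] c_pos[of "Suc n"] by (intro mult_right_mono) auto
      finally show "norm (\<Theta> n \<omega>) \<le> exp (suminf \<alpha>) * (\<Theta> n \<omega> / c (Suc n))"
        using \<Theta>(2)[OF elim(2), of n] by simp
    qed
    ultimately show ?case by simp
  qed
qed

end

section \<open>The deterministic forward-backward step\<close>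

text \<open>
  Surjectivity is the Lax-Milgram argument: solving \<open>U x = y\<close> amounts to finding a fixed point of
  \<open>x \<mapsto> x - t (U x - y)\<close>, a contraction for small \<open>t\<close>.
\<close>

lemma strongly_positive_inverse:
  fixes U :: "'h::{real_inner, banach} \<Rightarrow> 'h"
  assumes lin: "bounded_linear U" and sa: "self_adjoint U" and sp: "strongly_positive U"
  obtains V where "bounded_linear V" "self_adjoint V" "strongly_positive V"
    "\<And>x. U (V x) = x" "\<And>x. V (U x) = x"
proof -
  interpret U: bounded_linear U by fact
  obtain c where c: "c > 0" "\<And>x. c * (norm x)\<^sup>2 \<le> U x \<bullet> x"
    using sp unfolding strongly_positive_def by blast
  obtain K0 where K0: "K0 > 0" "\<And>x. norm (U x) \<le> norm x * K0" using U.pos_bounded by blast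
  \<comment> \<open>Enlarging the bound on \<open>U\<close> to at least \<open>c\<close> keeps the squared contraction factor \<open>q\<close> nonnegative.\<close>
  define K where "K = max K0 c"
  have K: "K > 0" "c \<le> K" using K0 by (auto simp: K_def)
  have normU: "norm (U x) \<le> K * norm x" for x
    using K0(2)[of x] mult_left_mono[of K0 K "norm x"] by (simp add: K_def mult.commute)
  have normU_sq: "(norm (U x))\<^sup>2 \<le> K\<^sup>2 * (norm x)\<^sup>2" for x
    using power_mono[OF normU[of x], of 2] by (simp add: power_mult_distrib)
  have lower: "c * norm x \<le> norm (U x)" for x
  proof (cases "x = 0")
    case False
    have "c * norm x * norm x \<le> norm (U x) * norm x"
      using c(2)[of x] norm_cauchy_schwarz[of "U x" x] by (simp add: power2_eq_square)
    then show ?thesis using False by simp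
  qed simp
  have "inj U"
  proof (rule injI)
    fix x y assume "U x = U y"
    then have "norm (U (x - y)) = 0" by (simp add: U.diff)
    then have "c * norm (x - y) \<le> 0" using lower[of "x - y"] by simp
    then show "x = y" using c(1) by (simp add: mult_le_0_iff)
  qed
  have "surj U"
  proof (rule surjI)
    \<comment> \<open>This \<open>t\<close> minimises \<open>1 - 2 t c + t\<^sup>2 K\<^sup>2\<close>, the bound on the squared Lipschitz constant.\<close>
    define t where "t = c / K\<^sup>2"
    define q where "q = 1 - c\<^sup>2 / K\<^sup>2"
    have "c\<^sup>2 \<le> K\<^sup>2" using K c(1) by (intro power_mono) auto
    then have q: "0 \<le> q" "q < 1" using K c(1) by (auto simp: q_def)
    have "\<exists>x. U x = y" for y
    proof -
      define f where "f x = x - t *\<^sub>R (U x - y)" for x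
      have "dist (f a) (f b) \<le> sqrt q * dist a b" for a b
      proof -
        define d where "d = a - b"
        have "f a - f b = d - t *\<^sub>R U d" by (simp add: f_def d_def U.diff algebra_simps)
        then have "(norm (f a - f b))\<^sup>2 = (norm d)\<^sup>2 - 2 * t * (U d \<bullet> d) + t\<^sup>2 * (norm (U d))\<^sup>2"
          unfolding power2_norm_eq_inner
          by (simp only:) (simp add: inner_diff_left inner_diff_right inner_commute
              power2_eq_square algebra_simps)
        also have "\<dots> \<le> (norm d)\<^sup>2 - 2 * t * (c * (norm d)\<^sup>2) + t\<^sup>2 * (K\<^sup>2 * (norm d)\<^sup>2)"
          using c K normU_sq[of d] by (intro add_mono diff_mono mult_left_mono) (auto simp: t_def)
        also have "\<dots> = q * (norm d)\<^sup>2"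
          using K(1) by (simp add: t_def q_def field_simps power2_eq_square)
        finally have "norm (f a - f b) \<le> sqrt (q * (norm d)\<^sup>2)" by (rule real_le_rsqrt)
        then show ?thesis by (simp add: dist_norm d_def real_sqrt_mult)
      qed
      then have "\<exists>!x. f x = x" using q by (intro banach_fix_type[of "sqrt q"]) auto
      then obtain x where "f x = x" by blast
      moreover have "t \<noteq> 0" using c(1) K(1) by (simp add: t_def)
      ultimately show ?thesis by (auto simp: f_def)
    qed
    then show "U (SOME x. U x = y) = y" for y by (rule someI_ex)
  qed
  define V where "V = inv U"
  have UV: "U (V x) = x" for x using \<open>surj U\<close> by (simp add: V_def surj_f_inv_f)
  have VU: "V (U x) = x" for x using \<open>inj U\<close> by (simp add: V_def)
  have "bounded_linear V"
  proof (rule bounded_linear_intro)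
    show "V (x + y) = V x + V y" for x y by (metis UV VU U.add)
    show "V (a *\<^sub>R x) = a *\<^sub>R V x" for a x by (metis UV VU U.scaleR)
    show "norm (V x) \<le> norm x * (1 / c)" for x
      using lower[of "V x"] c(1) by (simp add: UV field_simps)
  qed
  moreover have "self_adjoint V"
    unfolding self_adjoint_def using sa unfolding self_adjoint_def by (metis UV)
  moreover have "strongly_positive V"
    unfolding strongly_positive_def
  proof (intro exI conjI allI)
    show "c / K\<^sup>2 > 0" using c(1) K(1) by simp
    fix x
    have "c / K\<^sup>2 * (norm x)\<^sup>2 \<le> c / K\<^sup>2 * (K\<^sup>2 * (norm (V x))\<^sup>2)"
      using normU_sq[of "V x"] c(1) by (intro mult_left_mono) (auto simp: UV)
    also have "\<dots> = c * (norm (V x))\<^sup>2" using K(1) by simp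
    also have "\<dots> \<le> V x \<bullet> x" using c(2)[of "V x"] by (simp add: UV inner_commute)
    finally show "c / K\<^sup>2 * (norm x)\<^sup>2 \<le> V x \<bullet> x" .
  qed
  ultimately show ?thesis using UV VU by (rule that)
qed

text \<open>
  Otherwise adding the pair \<open>(x, u)\<close> to the graph would give a proper monotone extension.
\<close>

lemma maximally_monotone_memI:
  assumes "maximally_monotone A" and rel: "\<And>y v. v \<in> A y \<Longrightarrow> 0 \<le> (x - y) \<bullet> (u - v)"
  shows "u \<in> A x"
proof (rule ccontr)
  assume "u \<notin> A x"
  define A' where "A' = A(x := insert u (A x))"
  have gra': "gra A' = insert (x, u) (gra A)" by (auto simp: gra_def A'_def split: if_splits)
  have mono: "monotone_op A" using assms(1) unfolding maximally_monotone_def by blast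
  have "monotone_op A'"
    unfolding monotone_op_def gra'
  proof (intro ballI, clarify)
    fix y1 v1 y2 v2
    assume 1: "(y1, v1) \<in> insert (x, u) (gra A)" and 2: "(y2, v2) \<in> insert (x, u) (gra A)"
    have sym: "(y1 - y2) \<bullet> (v1 - v2) = (y2 - y1) \<bullet> (v2 - v1)"
      by (metis inner_minus_left inner_minus_right minus_diff_eq minus_minus)
    from 1 2 consider "(y1, v1) = (x, u)" "(y2, v2) = (x, u)" | "(y1, v1) = (x, u)" "v2 \<in> A y2"
      | "v1 \<in> A y1" "(y2, v2) = (x, u)" | "(y1, v1) \<in> gra A" "(y2, v2) \<in> gra A"
      by (auto simp: gra_def)
    then show "0 \<le> (y1 - y2) \<bullet> (v1 - v2)"
    proof cases
      case 3
      then show ?thesis using rel[of v1 y1] sym by simp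
    next
      case 4
      then show ?thesis using mono unfolding monotone_op_def by blast
    qed (use rel in auto)
  qed
  moreover have "gra A \<subset> gra A'" using \<open>u \<notin> A x\<close> unfolding gra' by (auto simp: gra_def)
  ultimately show False using assms(1) unfolding maximally_monotone_def by blast
qed

text \<open>
  The inequality \<open>0 \<le> (y\<^sub>n - a) \<bullet> (v\<^sub>n - b)\<close> survives in the limit because one factor converges weakly
  and boundedly, the other strongly; maximality then puts the limit into the graph.
\<close>

lemma maximally_monotone_weak_strong_closed:
  assumes A: "maximally_monotone A" and v: "\<And>n. v n \<in> A (y n)"
    and bd: "\<And>n. norm (y n) \<le> C" and "weakly_tendsto y l" and "v \<longlonglongrightarrow> u"
  shows "u \<in> A l"
proof (rule maximally_monotone_memI[OF A])
  fix a b assume b: "b \<in> A a"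
  have "(\<lambda>n. y n \<bullet> (v n - b)) \<longlonglongrightarrow> l \<bullet> (u - b)"
    using assms by (intro weak_strong_inner[where C = C] tendsto_diff tendsto_const) auto
  moreover have "(\<lambda>n. a \<bullet> (v n - b)) \<longlonglongrightarrow> a \<bullet> (u - b)"
    using assms(5) by (intro tendsto_inner tendsto_diff tendsto_const)
  ultimately have "(\<lambda>n. y n \<bullet> (v n - b) - a \<bullet> (v n - b)) \<longlonglongrightarrow> l \<bullet> (u - b) - a \<bullet> (u - b)"
    by (rule tendsto_diff)
  then have "(\<lambda>n. (y n - a) \<bullet> (v n - b)) \<longlonglongrightarrow> (l - a) \<bullet> (u - b)"
    by (simp add: inner_diff_left)
  moreover have "0 \<le> (y n - a) \<bullet> (v n - b)" for n
    using A v[of n] b unfolding maximally_monotone_def monotone_op_def gra_def by blast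
  ultimately show "0 \<le> (l - a) \<bullet> (u - b)" by (intro LIMSEQ_le_const) auto
qed

lemma mem_resolvent_scaled_opE:
  assumes "p \<in> resolvent (scaled_op \<gamma> U A) z"
  obtains a where "a \<in> A p" "z = p + \<gamma> *\<^sub>R U a"
  using assms unfolding resolvent_def scaled_op_def by blast

text \<open>
  The inclusion \<open>0 \<in> A y + B y\<close> with preconditioner \<open>U\<close> and inverse \<open>V\<close>.  The real parameters are
  quantitative bounds: \<open>\<mu>\<close> and \<open>\<kappa>\<close> from below and \<open>K\<close> and \<open>L\<close> from above, for \<open>U\<close> and \<open>V\<close> respectively.
\<close>

locale preconditioned_inclusion =
  fixes U V B :: "'h::{real_inner, banach, second_countable_topology} \<Rightarrow> 'h"
    and A :: "'h \<Rightarrow> 'h set" and \<beta> \<mu> \<kappa> K L :: real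
  assumes U_lin: "bounded_linear U" and V_lin: "bounded_linear V"
    and V_sa: "self_adjoint V"
    and UV [simp]: "\<And>x. U (V x) = x" and VU [simp]: "\<And>x. V (U x) = x"
    and A_max: "maximally_monotone A"
    and \<beta>_pos: "\<beta> > 0"
    and cocoercive: "\<And>x y. \<beta> * ((B x - B y) \<bullet> U (B x - B y)) \<le> (x - y) \<bullet> (B x - B y)"
    and \<mu>: "\<mu> > 0" "\<And>x. \<mu> * (norm x)\<^sup>2 \<le> U x \<bullet> x"
    and \<kappa>: "\<kappa> > 0" "\<And>x. \<kappa> * (norm x)\<^sup>2 \<le> V x \<bullet> x"
    and K: "K > 0" "\<And>x. norm (U x) \<le> K * norm x"
    and L: "L > 0" "\<And>x. norm (V x) \<le> L * norm x"
begin

sublocale U: bounded_linear U by (rule U_lin)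
sublocale V: bounded_linear V by (rule V_lin)

text \<open>
  The squared norm in which the iteration contracts; \<open>Q\<close> of a sum is expanded with \<open>V (U v) = v\<close>, which
  turns the cross terms with \<open>U a\<close> and \<open>U (B w)\<close> into plain inner products.
\<close>

definition Q :: "'h \<Rightarrow> real" where "Q x = x \<bullet> V x"

definition zeros :: "'h set" where "zeros = {y. - B y \<in> A y}"

lemma V_sym: "x \<bullet> V y = y \<bullet> V x"
  using V_sa unfolding self_adjoint_def by (metis inner_commute)

lemma Q_lower: "\<kappa> * (norm x)\<^sup>2 \<le> Q x"
  using \<kappa>(2)[of x] by (simp add: Q_def inner_commute)

lemma Q_nonneg: "0 \<le> Q x"
proof -
  have "0 \<le> \<kappa> * (norm x)\<^sup>2" using \<kappa>(1) by simp
  then show ?thesis using Q_lower[of x] by linarith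
qed

lemma Q_upper: "Q x \<le> L * (norm x)\<^sup>2"
proof -
  have "Q x \<le> norm x * norm (V x)" unfolding Q_def by (rule norm_cauchy_schwarz)
  also have "\<dots> \<le> norm x * (L * norm x)" by (intro mult_left_mono L) auto
  finally show ?thesis by (simp add: power2_eq_square algebra_simps)
qed

lemma Q_add: "Q (x + y) = Q x + 2 * (x \<bullet> V y) + Q y"
  using V_sym[of x y] by (simp add: Q_def V.add inner_add_left inner_add_right)

lemma Q_scaleR: "Q (c *\<^sub>R x) = c\<^sup>2 * Q x"
  by (simp add: Q_def V.scaleR power2_eq_square)

lemma Q_diff: "Q (x - y) = Q x - 2 * (x \<bullet> V y) + Q y"
  using Q_add[of x "(-1) *\<^sub>R y"] Q_scaleR[of "-1" y] by (simp add: V.neg)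

lemma Q_diff_scaled_U: "Q (s - c *\<^sub>R U v) = Q s - 2 * c * (s \<bullet> v) + c\<^sup>2 * (v \<bullet> U v)"
proof -
  have "Q (U v) = v \<bullet> U v" by (simp add: Q_def inner_commute)
  then show ?thesis by (simp add: Q_diff Q_scaleR V.scaleR)
qed

lemma Q_cross_le: "2 * (x \<bullet> V y) \<le> Q x + Q y"
  using Q_nonneg[of "x - y"] by (simp add: Q_diff)

text \<open>
  The defect in the convexity inequality is \<open>l (1 - l) Q (x - y)\<close>.
\<close>

lemma Q_convex:
  assumes "0 \<le> l" "l \<le> 1"
  shows "Q (x + l *\<^sub>R (y - x)) \<le> (1 - l) * Q x + l * Q y"
proof -
  have "Q (x + l *\<^sub>R (y - x)) = (1 - l) * Q x + l * Q y - l * (1 - l) * Q (x - y)"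
    using V_sym[of x y] by (simp add: Q_def V.add V.diff V.scaleR inner_simps algebra_simps power2_eq_square)
  moreover have "0 \<le> l * (1 - l) * Q (x - y)" using assms Q_nonneg by simp
  ultimately show ?thesis by linarith
qed

lemma U_inner_upper: "x \<bullet> U x \<le> K * (norm x)\<^sup>2"
proof -
  have "x \<bullet> U x \<le> norm x * norm (U x)" by (rule norm_cauchy_schwarz)
  also have "\<dots> \<le> norm x * (K * norm x)" by (intro mult_left_mono K) auto
  finally show ?thesis by (simp add: power2_eq_square algebra_simps)
qed

lemma B_lipschitz: "norm (B x - B y) \<le> norm (x - y) / (\<beta> * \<mu>)"
proof (cases "B x = B y")
  case False
  let ?b = "norm (B x - B y)"
  have "\<beta> * (\<mu> * ?b\<^sup>2) \<le> \<beta> * ((B x - B y) \<bullet> U (B x - B y))"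
    using \<mu>(2)[of "B x - B y"] \<beta>_pos by (simp add: inner_commute)
  also have "\<dots> \<le> norm (x - y) * ?b"
    using cocoercive[of x y] norm_cauchy_schwarz[of "x - y" "B x - B y"] by linarith
  finally have "(\<beta> * \<mu> * ?b) * ?b \<le> norm (x - y) * ?b" by (simp add: power2_eq_square algebra_simps)
  then have "\<beta> * \<mu> * ?b \<le> norm (x - y)" using False by simp
  then show ?thesis using \<beta>_pos \<mu>(1) by (simp add: field_simps)
qed (use \<beta>_pos \<mu> in simp)

lemma B_continuous: "continuous_on UNIV B"
proof (rule continuous_onI)
  fix x and e :: real assume "e > 0"
  have "dist (B y) (B x) \<le> e" if "dist y x < e * (\<beta> * \<mu>)" for y
  proof -
    have "dist (B y) (B x) \<le> dist y x / (\<beta> * \<mu>)" using B_lipschitz by (simp add: dist_norm)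
    also have "\<dots> \<le> e" using that \<beta>_pos \<mu>(1) by (simp add: pos_divide_le_eq less_imp_le)
    finally show ?thesis .
  qed
  moreover have "e * (\<beta> * \<mu>) > 0" using \<open>e > 0\<close> \<beta>_pos \<mu>(1) by simp
  ultimately show "\<exists>d>0. \<forall>x'\<in>UNIV. dist x' x < d \<longrightarrow> dist (B x') (B x) \<le> e" by blast
qed

text \<open>
  Firm nonexpansiveness of the resolvent in the metric \<open>Q\<close>, comparing \<open>z\<close> with the point
  \<open>y - \<gamma> U (B y)\<close>, whose image under the resolvent is \<open>y\<close>.
\<close>

lemma resolvent_firm:
  assumes y: "y \<in> zeros" and "0 \<le> \<gamma>" and p: "p \<in> resolvent (scaled_op \<gamma> U A) z"
  shows "Q (p - y) + Q (z - p + \<gamma> *\<^sub>R U (B y)) \<le> Q (z - (y - \<gamma> *\<^sub>R U (B y)))"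
proof -
  obtain a where a: "a \<in> A p" "z = p + \<gamma> *\<^sub>R U a" using p by (rule mem_resolvent_scaled_opE)
  have "0 \<le> (p - y) \<bullet> (a - (- B y))"
    using A_max a(1) y unfolding maximally_monotone_def monotone_op_def gra_def zeros_def by blast
  then have "0 \<le> 2 * \<gamma> * ((p - y) \<bullet> (a + B y))" using \<open>0 \<le> \<gamma>\<close> by simp
  moreover have z: "z - p + \<gamma> *\<^sub>R U (B y) = \<gamma> *\<^sub>R U (a + B y)"
    by (simp add: a(2) U.add scaleR_add_right)
  have "z - (y - \<gamma> *\<^sub>R U (B y)) = (p - y) + \<gamma> *\<^sub>R U (a + B y)"
    using z by (simp add: algebra_simps)
  then have "Q (z - (y - \<gamma> *\<^sub>R U (B y)))
    = Q (p - y) + 2 * \<gamma> * ((p - y) \<bullet> (a + B y)) + Q (\<gamma> *\<^sub>R U (a + B y))"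
    by (simp only:) (simp add: Q_add V.scaleR)
  ultimately show ?thesis using z by simp
qed

text \<open>
  The gradient-like step with the exact value \<open>B w\<close> contracts \<open>Q\<close> by cocoercivity, as \<open>\<gamma> \<le> 2 \<beta>\<close>.
  Replacing \<open>B w\<close> by \<open>r\<close> costs a quadratic term and a cross term linear in \<open>r - B w\<close>.
\<close>

lemma forward_step:
  fixes w y r :: 'h
  assumes "0 \<le> \<gamma>" "\<gamma> \<le> 2 * \<beta>"
  defines "b \<equiv> B w - B y" and "e \<equiv> r - B w"
  shows "Q (w - \<gamma> *\<^sub>R U r - (y - \<gamma> *\<^sub>R U (B y)))
    \<le> Q (w - y) - \<gamma> * (2 * \<beta> - \<gamma>) * \<mu> * (norm b)\<^sup>2 + \<gamma>\<^sup>2 * K * (norm e)\<^sup>2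
      - 2 * \<gamma> * ((w - y - \<gamma> *\<^sub>R U b) \<bullet> e)"
proof -
  define s where "s = w - y - \<gamma> *\<^sub>R U b"
  have split: "w - \<gamma> *\<^sub>R U r - (y - \<gamma> *\<^sub>R U (B y)) = s - \<gamma> *\<^sub>R U e"
    by (simp add: s_def b_def e_def U.diff algebra_simps)
  have "Q (s - \<gamma> *\<^sub>R U e) = Q s - 2 * \<gamma> * (s \<bullet> e) + \<gamma>\<^sup>2 * (e \<bullet> U e)"
    by (rule Q_diff_scaled_U)
  moreover have "\<gamma>\<^sup>2 * (e \<bullet> U e) \<le> \<gamma>\<^sup>2 * K * (norm e)\<^sup>2"
    using U_inner_upper[of e] by (simp add: mult_left_mono mult.assoc)
  moreover have "Q s = Q (w - y) - 2 * \<gamma> * ((w - y) \<bullet> b) + \<gamma>\<^sup>2 * (b \<bullet> U b)"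
    unfolding s_def by (rule Q_diff_scaled_U)
  moreover have "2 * \<gamma> * (\<beta> * (b \<bullet> U b)) \<le> 2 * \<gamma> * ((w - y) \<bullet> b)"
    using cocoercive[of w y] \<open>0 \<le> \<gamma>\<close> by (simp add: b_def mult_left_mono)
  moreover have "\<gamma> * (2 * \<beta> - \<gamma>) * (\<mu> * (norm b)\<^sup>2) \<le> \<gamma> * (2 * \<beta> - \<gamma>) * (b \<bullet> U b)"
    using assms \<mu>(2)[of b] by (intro mult_left_mono) (auto simp: inner_commute)
  ultimately show ?thesis unfolding split s_def[symmetric]
    by (simp add: algebra_simps power2_eq_square)
qed

text \<open>
  Young's inequality for the cross term; \<open>\<alpha> \<le> 1\<close> absorbs the quadratic term.
\<close>

lemma inertial_step:
  assumes "0 \<le> \<alpha>" "\<alpha> \<le> 1"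
  shows "Q (x + \<alpha> *\<^sub>R d - y) \<le> (1 + \<alpha>) * Q (x - y) + 2 * \<alpha> * Q d"
proof -
  have "x + \<alpha> *\<^sub>R d - y = (x - y) + \<alpha> *\<^sub>R d" by simp
  then have "Q (x + \<alpha> *\<^sub>R d - y) = Q (x - y) + \<alpha> * (2 * ((x - y) \<bullet> V d)) + \<alpha> * \<alpha> * Q d"
    by (simp only: Q_add Q_scaleR V.scaleR inner_scaleR_right power2_eq_square mult.left_commute)
  moreover have "\<alpha> * (2 * ((x - y) \<bullet> V d)) \<le> \<alpha> * (Q (x - y) + Q d)"
    using assms Q_cross_le by (intro mult_left_mono) auto
  moreover have "\<alpha> * \<alpha> * Q d \<le> \<alpha> * 1 * Q d"
    using assms Q_nonneg by (intro mult_right_mono mult_left_mono) auto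
  ultimately show ?thesis by (simp add: algebra_simps)
qed

text \<open>
  The factor \<open>l \<le> 1\<close> is dropped from every nonnegative term on the right, but kept in the cross term,
  whose sign is unknown and which disappears only after integration.
\<close>

lemma iteration_step:
  assumes y: "y \<in> zeros"
    and \<alpha>: "0 \<le> \<alpha>" "\<alpha> \<le> 1" and \<gamma>: "0 \<le> \<gamma>" "\<gamma> \<le> 2 * \<beta>" and l: "0 \<le> l" "l \<le> 1"
    and w: "w = x + \<alpha> *\<^sub>R d" and p: "p \<in> resolvent (scaled_op \<gamma> U A) (w - \<gamma> *\<^sub>R U r)"
  shows "Q (x + l *\<^sub>R (p - x) - y)
      + l * (\<gamma> * (2 * \<beta> - \<gamma>) * \<mu> * (norm (B w - B y))\<^sup>2 + \<kappa> * (norm (w - p - \<gamma> *\<^sub>R U (r - B y)))\<^sup>2)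
    \<le> (1 + \<alpha>) * Q (x - y) + 2 * \<alpha> * Q d + \<gamma>\<^sup>2 * K * (norm (r - B w))\<^sup>2
      - 2 * l * \<gamma> * ((w - y - \<gamma> *\<^sub>R U (B w - B y)) \<bullet> (r - B w))"
    (is "_ + l * (?b + ?m) \<le> _ + ?d + ?e - 2 * l * \<gamma> * ?c")
proof -
  have "x + l *\<^sub>R (p - x) - y = (x - y) + l *\<^sub>R ((p - y) - (x - y))" by simp
  then have 1: "Q (x + l *\<^sub>R (p - x) - y) \<le> (1 - l) * Q (x - y) + l * Q (p - y)"
    using Q_convex[OF l, of "x - y" "p - y"] by (simp only:)
  have m: "w - \<gamma> *\<^sub>R U r - p + \<gamma> *\<^sub>R U (B y) = w - p - \<gamma> *\<^sub>R U (r - B y)"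
    by (simp add: U.diff algebra_simps)
  have "Q (p - y) + ?m \<le> Q (w - \<gamma> *\<^sub>R U r - (y - \<gamma> *\<^sub>R U (B y)))"
    using resolvent_firm[OF y \<gamma>(1) p] Q_lower[of "w - p - \<gamma> *\<^sub>R U (r - B y)"] unfolding m by linarith
  also have "\<dots> \<le> Q (w - y) - ?b + ?e - 2 * \<gamma> * ?c" by (rule forward_step[OF \<gamma>])
  also have "Q (w - y) \<le> (1 + \<alpha>) * Q (x - y) + ?d" unfolding w by (rule inertial_step[OF \<alpha>])
  finally have "Q (p - y) \<le> (1 + \<alpha>) * Q (x - y) + ?d - ?b + ?e - 2 * \<gamma> * ?c - ?m" by simp
  from mult_left_mono[OF this l(1)]
  have 2: "l * Q (p - y) \<le> l * ((1 + \<alpha>) * Q (x - y)) + l * ?d + l * ?e - 2 * l * \<gamma> * ?c - l * (?b + ?m)"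
    by (simp add: algebra_simps)
  have 3: "l * t \<le> t" if "0 \<le> t" for t :: real using that l mult_right_mono[of l 1 t] by simp
  have "0 \<le> \<alpha> * Q (x - y)" "0 \<le> ?d" "0 \<le> ?e" using \<alpha> \<gamma> Q_nonneg K(1) by auto
  note bounds = 3[OF this(1)] 3[OF this(2)] 3[OF this(3)]
  have "(1 - l) * Q (x - y) + l * ((1 + \<alpha>) * Q (x - y)) = Q (x - y) + l * (\<alpha> * Q (x - y))"
    and "(1 + \<alpha>) * Q (x - y) = Q (x - y) + \<alpha> * Q (x - y)"
    by (simp_all add: algebra_simps)
  with bounds 1 2 show ?thesis by linarith
qed

text \<open>
  All probabilistic information has been turned into limits along one path.  The metric \<open>Q\<close> enters
  through Opial's argument: convergence of \<open>Q (x\<^sub>n - d)\<close> for two points gives convergence of the inner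
  product of \<open>x\<^sub>n\<close> with \<open>V\<close> of their difference, which separates two weak cluster points.
\<close>

lemma pathwise_convergence:
  fixes x w p r :: "nat \<Rightarrow> 'h"
  assumes \<gamma>: "0 < \<epsilon>" "\<And>n. \<epsilon> \<le> \<gamma> n" "\<And>n. \<gamma> n \<le> G"
    and p: "\<And>n. p n \<in> resolvent (scaled_op (\<gamma> n) U A) (w n - \<gamma> n *\<^sub>R U (r n))"
    and y: "y \<in> zeros"
    and b0: "(\<lambda>n. B (w n) - B y) \<longlonglongrightarrow> 0"
    and m0: "(\<lambda>n. w n - p n - \<gamma> n *\<^sub>R U (r n - B y)) \<longlonglongrightarrow> 0"
    and e0: "(\<lambda>n. r n - B (w n)) \<longlonglongrightarrow> 0"
    and wx0: "(\<lambda>n. w n - x n) \<longlonglongrightarrow> 0"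
    and D: "D \<subseteq> zeros" "zeros \<subseteq> closure D"
    and fejer: "\<And>d. d \<in> D \<Longrightarrow> convergent (\<lambda>n. Q (x n - d))"
  shows "\<exists>l\<in>zeros. weakly_tendsto x l \<and> (\<lambda>n. B (x n)) \<longlonglongrightarrow> B l"
proof -
  have "D \<noteq> {}" using D y by auto
  then obtain d0 where d0: "d0 \<in> D" by blast
  obtain R where R: "\<And>n. norm (Q (x n - d0)) \<le> R"
    using convergent_imp_bounded[of "\<lambda>n. Q (x n - d0)"] fejer[OF d0]
    by (auto simp: convergent_def bounded_iff)
  define C where "C = norm d0 + sqrt (R / \<kappa>)"
  have bd: "norm (x n) \<le> C" for n
  proof -
    have "\<kappa> * (norm (x n - d0))\<^sup>2 \<le> R" using Q_lower[of "x n - d0"] R[of n] by simp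
    then have "(norm (x n - d0))\<^sup>2 \<le> R / \<kappa>" using \<kappa>(1) by (simp add: field_simps)
    then have "norm (x n - d0) \<le> sqrt (R / \<kappa>)" by (rule real_le_rsqrt)
    then show ?thesis using norm_triangle_ineq[of "x n - d0" d0] by (simp add: C_def)
  qed

  have rB: "(\<lambda>n. r n - B y) \<longlonglongrightarrow> 0" using tendsto_add[OF e0 b0] by simp
  have "(\<lambda>n. \<gamma> n *\<^sub>R U (r n - B y)) \<longlonglongrightarrow> 0"
  proof (rule Lim_null_comparison[OF always_eventually[OF allI]])
    show "norm (\<gamma> n *\<^sub>R U (r n - B y)) \<le> G * norm (U (r n - B y))" for n
      using \<gamma>(1) \<gamma>(2,3)[of n] by (simp add: mult_right_mono)
    show "(\<lambda>n. G * norm (U (r n - B y))) \<longlonglongrightarrow> 0"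
      using tendsto_mult_left[OF tendsto_norm[OF U.tendsto[OF rB]], of G] by (simp add: U.zero)
  qed
  from tendsto_add[OF m0 this] have wp: "(\<lambda>n. w n - p n) \<longlonglongrightarrow> 0" by simp
  have px: "(\<lambda>n. p n - x n) \<longlonglongrightarrow> 0" using tendsto_diff[OF wx0 wp] by simp

  \<comment> \<open>The element of \<open>A (p n)\<close> that witnesses the resolvent relation, solved for with \<open>V = U\<inverse>\<close>.\<close>
  define a where "a n = (1 / \<gamma> n) *\<^sub>R V (w n - p n) - r n" for n
  have aA: "a n \<in> A (p n)" for n
  proof -
    obtain u where u: "u \<in> A (p n)" "w n - \<gamma> n *\<^sub>R U (r n) = p n + \<gamma> n *\<^sub>R U u"
      using p[of n] by (rule mem_resolvent_scaled_opE)
    then have "w n - p n = \<gamma> n *\<^sub>R U (u + r n)" by (simp add: U.add algebra_simps)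
    then have "a n = u" using \<gamma>(1) \<gamma>(2)[of n] by (simp add: a_def V.scaleR)
    then show ?thesis using u(1) by simp
  qed
  have "(\<lambda>n. (1 / \<gamma> n) *\<^sub>R V (w n - p n)) \<longlonglongrightarrow> 0"
  proof (rule Lim_null_comparison[OF always_eventually[OF allI]])
    show "norm ((1 / \<gamma> n) *\<^sub>R V (w n - p n)) \<le> 1 / \<epsilon> * norm (V (w n - p n))" for n
      using \<gamma>(1) \<gamma>(2)[of n] by (simp add: frac_le)
    show "(\<lambda>n. 1 / \<epsilon> * norm (V (w n - p n))) \<longlonglongrightarrow> 0"
      using tendsto_mult_left[OF tendsto_norm[OF V.tendsto[OF wp]], of "1 / \<epsilon>"] by (simp add: V.zero)
  qed
  from tendsto_diff[OF tendsto_diff[OF this rB] tendsto_const[of "B y"]]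
  have a_lim: "a \<longlonglongrightarrow> - B y" by (simp add: a_def[abs_def])

  have "(\<lambda>n. B (x n) - B (w n)) \<longlonglongrightarrow> 0"
  proof (rule Lim_null_comparison[OF always_eventually[OF allI]])
    show "norm (B (x n) - B (w n)) \<le> norm (w n - x n) / (\<beta> * \<mu>)" for n
      using B_lipschitz[of "x n" "w n"] by (simp add: norm_minus_commute)
    show "(\<lambda>n. norm (w n - x n) / (\<beta> * \<mu>)) \<longlonglongrightarrow> 0"
      using tendsto_divide[OF tendsto_norm[OF wx0] tendsto_const, of "\<beta> * \<mu>"] \<beta>_pos \<mu>(1) by simp
  qed
  from tendsto_add[OF tendsto_add[OF this b0] tendsto_const[of "B y"]]
  have Bx: "(\<lambda>n. B (x n)) \<longlonglongrightarrow> B y" by simp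

  have cluster: "l \<in> zeros \<and> B l = B y" if s: "strict_mono s" "weakly_tendsto (x \<circ> s) l" for s l
  proof -
    have bds: "norm ((x \<circ> s) n) \<le> C" for n using bd by simp
    have Bxs: "(\<lambda>n. B ((x \<circ> s) n)) \<longlonglongrightarrow> B y"
      using LIMSEQ_subseq_LIMSEQ[OF Bx s(1)] by (simp add: o_def)
    have Bd: "(\<lambda>n. B ((x \<circ> s) n) - B l) \<longlonglongrightarrow> B y - B l"
      by (intro tendsto_diff tendsto_const Bxs)
    from tendsto_diff[OF weak_strong_inner[OF bds s(2) Bd] tendsto_inner[OF tendsto_const Bd]]
    have "(\<lambda>n. (x \<circ> s) n \<bullet> (B ((x \<circ> s) n) - B l) - l \<bullet> (B ((x \<circ> s) n) - B l))
        \<longlonglongrightarrow> l \<bullet> (B y - B l) - l \<bullet> (B y - B l)" .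
    then have prod0: "(\<lambda>n. ((x \<circ> s) n - l) \<bullet> (B ((x \<circ> s) n) - B l)) \<longlonglongrightarrow> 0"
      by (simp add: inner_diff_left)
    have "(\<lambda>n. \<beta> * \<mu> * (norm (B ((x \<circ> s) n) - B l))\<^sup>2) \<longlonglongrightarrow> \<beta> * \<mu> * (norm (B y - B l))\<^sup>2"
      by (intro tendsto_mult tendsto_const tendsto_power tendsto_norm tendsto_diff Bxs)
    moreover have "\<beta> * \<mu> * (norm (B v - B l))\<^sup>2 \<le> (v - l) \<bullet> (B v - B l)" for v
    proof -
      have "\<beta> * (\<mu> * (norm (B v - B l))\<^sup>2) \<le> \<beta> * ((B v - B l) \<bullet> U (B v - B l))"
        using \<mu>(2)[of "B v - B l"] \<beta>_pos by (simp add: inner_commute)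
      then show ?thesis using cocoercive[of v l] by (simp add: mult.assoc)
    qed
    \<comment> \<open>The right-hand sides tend to \<open>0\<close> along \<open>x \<circ> s\<close> by weak convergence of one factor and strong
        convergence of the other, so cocoercivity identifies the limit of \<open>B\<close>.\<close>
    ultimately have "\<beta> * \<mu> * (norm (B y - B l))\<^sup>2 \<le> 0"
      using prod0 by (intro LIMSEQ_le) auto
    then have "(norm (B y - B l))\<^sup>2 \<le> 0"
      using \<beta>_pos \<mu>(1) by (simp add: mult_le_0_iff zero_less_mult_iff)
    then have Bl: "B l = B y" by simp
    have pxs: "(\<lambda>n. (p \<circ> s) n - (x \<circ> s) n) \<longlonglongrightarrow> 0"
      using LIMSEQ_subseq_LIMSEQ[OF px s(1)] by (simp add: o_def)
    from weakly_tendsto_add_null[OF s(2) pxs] have pw: "weakly_tendsto (p \<circ> s) l"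
      by (simp add: o_def)
    obtain C' where C': "\<And>n. norm ((p \<circ> s) n - (x \<circ> s) n) \<le> C'"
      using convergent_imp_bounded[OF pxs] by (auto simp: bounded_iff)
    have pbd: "norm ((p \<circ> s) n) \<le> C' + C" for n
      using norm_triangle_ineq[of "(p \<circ> s) n - (x \<circ> s) n" "(x \<circ> s) n"] C'[of n] bds[of n] by simp
    have "(a \<circ> s) n \<in> A ((p \<circ> s) n)" for n using aA by simp
    from maximally_monotone_weak_strong_closed[OF A_max this pbd pw LIMSEQ_subseq_LIMSEQ[OF a_lim s(1)]]
    have "- B y \<in> A l" .
    then show ?thesis using Bl by (simp add: zeros_def)
  qed

  have inner_conv: "convergent (\<lambda>n. x n \<bullet> V (y1 - y2))" if "y1 \<in> zeros" "y2 \<in> zeros" for y1 y2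
  proof (rule bounded_inner_convergent_closure[OF bd])
    let ?E = "(\<lambda>(d1, d2). V (d1 - d2)) ` (D \<times> D)"
    show "convergent (\<lambda>n. x n \<bullet> h)" if hE: "h \<in> ?E" for h
    proof -
      obtain d1 d2 where d: "d1 \<in> D" "d2 \<in> D" "h = V (d1 - d2)" using hE by auto
      have "convergent (\<lambda>n. (1/2) * ((Q (x n - d2) - Q (x n - d1)) + (Q d1 - Q d2)))"
        using fejer d by (intro convergent_mult convergent_add convergent_diff convergent_const)
      moreover have "(1/2) * ((Q (x n - d2) - Q (x n - d1)) + (Q d1 - Q d2)) = x n \<bullet> h" for n
        by (simp add: Q_diff d(3) V.diff inner_diff_right)
      ultimately show ?thesis by simp
    qed
    have "continuous_on (closure (D \<times> D)) (\<lambda>(d1, d2). V (d1 - d2))"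
      unfolding case_prod_unfold by (intro V.continuous_on continuous_intros)
    then have "(\<lambda>(d1, d2). V (d1 - d2)) ` closure (D \<times> D) \<subseteq> closure ?E"
      by (intro image_closure_subset) (auto intro: closure_subset[THEN subsetD])
    moreover have "(y1, y2) \<in> closure (D \<times> D)" using that D(2) by (auto simp: closure_Times)
    ultimately show "V (y1 - y2) \<in> closure ?E" by force
  qed
  have unique: "l = l'" if s: "strict_mono s" "weakly_tendsto (x \<circ> s) l"
    and t: "strict_mono t" "weakly_tendsto (x \<circ> t) l'" for s t l l'
  proof -
    obtain c where c: "(\<lambda>n. x n \<bullet> V (l - l')) \<longlonglongrightarrow> c"
      using inner_conv[OF conjunct1[OF cluster[OF s]] conjunct1[OF cluster[OF t]]]
      unfolding convergent_def by blast
    have along: "m \<bullet> V (l - l') = c" if u: "strict_mono u" "weakly_tendsto (x \<circ> u) m" for u m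
    proof (rule LIMSEQ_unique)
      show "(\<lambda>n. (x \<circ> u) n \<bullet> V (l - l')) \<longlonglongrightarrow> m \<bullet> V (l - l')"
        using u(2) unfolding weakly_tendsto_def by blast
      show "(\<lambda>n. (x \<circ> u) n \<bullet> V (l - l')) \<longlonglongrightarrow> c"
        using LIMSEQ_subseq_LIMSEQ[OF c u(1)] by (simp add: o_def)
    qed
    have "Q (l - l') = 0" using along[OF s] along[OF t] by (simp add: Q_def inner_diff_left)
    then have "(norm (l - l'))\<^sup>2 \<le> 0" using Q_lower[of "l - l'"] \<kappa>(1) by (simp add: mult_le_0_iff)
    then show ?thesis by simp
  qed
  obtain s l where s: "strict_mono s" "weakly_tendsto (x \<circ> s) l"
    using bd by (rule weak_sequential_compactness)
  have "weakly_tendsto x l"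
    using unique[OF _ _ s] by (intro weakly_tendsto_of_unique_cluster[OF bd])
  then show ?thesis using cluster[OF s] Bx by auto
qed

end

section \<open>Square integrable vector-valued random variables\<close>

text \<open>
  A centred \<open>e\<close> is orthogonal to everything that is measurable with respect to the past: immediate for
  simple functions \<open>s\<close>, and dominated convergence does the rest.
\<close>

lemma integral_inner_eq_0:
  fixes s e :: "'o \<Rightarrow> 'h::{real_inner, banach, second_countable_topology}"
  assumes sub: "subalgebra M F" and s: "s \<in> borel_measurable F" and e: "integrable M e"
    and zero: "\<And>D. D \<in> sets F \<Longrightarrow> (\<integral>\<omega>. indicator D \<omega> *\<^sub>R e \<omega> \<partial>M) = 0"
    and int: "integrable M (\<lambda>\<omega>. norm (s \<omega>) * norm (e \<omega>))"
  shows "(\<integral>\<omega>. s \<omega> \<bullet> e \<omega> \<partial>M) = 0"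
proof -
  have space: "space F = space M" using sub by (simp add: subalgebra_def)
  have [measurable]: "e \<in> borel_measurable M" using e by simp
  have [measurable]: "s \<in> borel_measurable M" using measurable_from_subalg[OF sub s] .
  obtain S where S: "\<And>i. simple_function F (S i)" "\<And>\<omega>. \<omega> \<in> space M \<Longrightarrow> (\<lambda>i. S i \<omega>) \<longlonglongrightarrow> s \<omega>"
    "\<And>i \<omega>. \<omega> \<in> space M \<Longrightarrow> norm (S i \<omega>) \<le> 2 * norm (s \<omega>)"
    using borel_measurable_implies_sequence_metric[OF s, of 0] unfolding space dist_norm diff_zero
    by blast
  have [measurable]: "S i \<in> borel_measurable M" for i
    using measurable_from_subalg[OF sub borel_measurable_simple_function[OF S(1)]] .
  have simple: "(\<integral>\<omega>. S i \<omega> \<bullet> e \<omega> \<partial>M) = 0" for i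
  proof -
    let ?R = "S i ` space M" and ?D = "\<lambda>v. S i -` {v} \<inter> space M"
    have fin: "finite ?R" using S(1)[of i] by (simp add: simple_function_def space)
    have D: "?D v \<in> sets F" for v using simple_functionD(2)[OF S(1), of i "{v}"] by (simp add: space)
    then have DM: "?D v \<in> sets M" for v using sub by (auto simp: subalgebra_def)
    have De: "integrable M (\<lambda>\<omega>. indicator (?D v) \<omega> *\<^sub>R e \<omega>)" for v
      by (rule integrable_mult_indicator[OF DM e])
    have "(\<integral>\<omega>. S i \<omega> \<bullet> e \<omega> \<partial>M) = (\<integral>\<omega>. (\<Sum>v\<in>?R. v \<bullet> (indicator (?D v) \<omega> *\<^sub>R e \<omega>)) \<partial>M)"
    proof (rule Bochner_Integration.integral_cong[OF refl])
      fix \<omega> assume \<omega>: "\<omega> \<in> space M"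
      have "(\<Sum>v\<in>?R. v \<bullet> (indicator (?D v) \<omega> *\<^sub>R e \<omega>)) = (\<Sum>v\<in>?R. if v = S i \<omega> then v \<bullet> e \<omega> else 0)"
        using \<omega> by (intro sum.cong) (auto simp: indicator_def)
      also have "\<dots> = S i \<omega> \<bullet> e \<omega>" using fin \<omega> by (simp add: sum.delta')
      finally show "S i \<omega> \<bullet> e \<omega> = (\<Sum>v\<in>?R. v \<bullet> (indicator (?D v) \<omega> *\<^sub>R e \<omega>))" by simp
    qed
    also have "\<dots> = (\<Sum>v\<in>?R. \<integral>\<omega>. v \<bullet> (indicator (?D v) \<omega> *\<^sub>R e \<omega>) \<partial>M)"
      by (intro Bochner_Integration.integral_sum integrable_inner_right De)
    also have "\<dots> = (\<Sum>v\<in>?R. v \<bullet> (\<integral>\<omega>. indicator (?D v) \<omega> *\<^sub>R e \<omega> \<partial>M))"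
      by (intro sum.cong refl integral_inner_right De)
    also have "\<dots> = 0" using zero[OF D] by simp
    finally show ?thesis .
  qed
  have "(\<lambda>i. \<integral>\<omega>. S i \<omega> \<bullet> e \<omega> \<partial>M) \<longlonglongrightarrow> (\<integral>\<omega>. s \<omega> \<bullet> e \<omega> \<partial>M)"
  proof (rule integral_dominated_convergence[where w = "\<lambda>\<omega>. 2 * (norm (s \<omega>) * norm (e \<omega>))"])
    show "integrable M (\<lambda>\<omega>. 2 * (norm (s \<omega>) * norm (e \<omega>)))" using int by simp
    show "AE \<omega> in M. (\<lambda>i. S i \<omega> \<bullet> e \<omega>) \<longlonglongrightarrow> s \<omega> \<bullet> e \<omega>"
      using S(2) by (intro AE_I2 tendsto_inner tendsto_const)
    show "AE \<omega> in M. norm (S i \<omega> \<bullet> e \<omega>) \<le> 2 * (norm (s \<omega>) * norm (e \<omega>))" for i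
    proof (rule AE_I2)
      fix \<omega> assume "\<omega> \<in> space M"
      have "norm (S i \<omega> \<bullet> e \<omega>) \<le> norm (S i \<omega>) * norm (e \<omega>)" using Cauchy_Schwarz_ineq2 by simp
      also have "\<dots> \<le> (2 * norm (s \<omega>)) * norm (e \<omega>)"
        using S(3)[OF \<open>\<omega> \<in> space M\<close>] by (intro mult_right_mono) auto
      finally show "norm (S i \<omega> \<bullet> e \<omega>) \<le> 2 * (norm (s \<omega>) * norm (e \<omega>))" by simp
    qed
  qed measurable
  then show ?thesis using simple by (simp add: LIMSEQ_const_iff)
qed

text \<open>
  For an integrable \<open>f\<close> the extended conditional expectation is finite almost everywhere, so passing to
  real values loses nothing.
\<close>

lemma (in sigma_finite_subalgebra) real_version_nn_cond_exp:
  fixes f :: "'a \<Rightarrow> real"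
  assumes f: "integrable M f" "\<And>\<omega>. 0 \<le> f \<omega>"
  defines "h \<equiv> \<lambda>\<omega>. enn2real (nn_cond_exp M F (\<lambda>\<omega>. ennreal (f \<omega>)) \<omega>)"
  shows "h \<in> borel_measurable F" "integrable M h"
    "\<And>D. D \<in> sets F \<Longrightarrow> (\<integral>\<omega>. indicator D \<omega> * h \<omega> \<partial>M) = (\<integral>\<omega>. indicator D \<omega> * f \<omega> \<partial>M)"
proof -
  let ?n = "nn_cond_exp M F (\<lambda>\<omega>. ennreal (f \<omega>))"
  have [measurable]: "f \<in> borel_measurable M" using f(1) by simp
  show hF: "h \<in> borel_measurable F" unfolding h_def by measurable
  have [measurable]: "h \<in> borel_measurable M" using measurable_from_subalg[OF subalg hF] .
  have total: "(\<integral>\<^sup>+\<omega>. ?n \<omega> \<partial>M) = (\<integral>\<^sup>+\<omega>. ennreal (f \<omega>) \<partial>M)"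
    using nn_cond_exp_intg[of "\<lambda>_. 1" "\<lambda>\<omega>. ennreal (f \<omega>)"] by simp
  also have fin: "\<dots> < \<infinity>" using f by (simp add: nn_integral_eq_integral less_top[symmetric])
  finally have "AE \<omega> in M. ?n \<omega> \<noteq> \<infinity>" by (intro nn_integral_PInf_AE) auto
  then have h_eq: "AE \<omega> in M. ennreal (h \<omega>) = ?n \<omega>"
    by eventually_elim (simp add: h_def less_top[symmetric])
  have "(\<integral>\<^sup>+\<omega>. ennreal (h \<omega>) \<partial>M) = (\<integral>\<^sup>+\<omega>. ?n \<omega> \<partial>M)" using h_eq by (rule nn_integral_cong_AE)
  then show "integrable M h"
    using total fin by (intro integrableI_nonneg) (auto simp: h_def)
  fix D assume D: "D \<in> sets F"
  have [measurable]: "D \<in> sets M" using D subalg by (auto simp: subalgebra_def)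
  have "(\<integral>\<^sup>+\<omega>. ennreal (indicator D \<omega> * h \<omega>) \<partial>M) = (\<integral>\<^sup>+\<omega>. indicator D \<omega> * ?n \<omega> \<partial>M)"
  proof (rule nn_integral_cong_AE)
    show "AE \<omega> in M. ennreal (indicator D \<omega> * h \<omega>) = indicator D \<omega> * ?n \<omega>"
      using h_eq by eventually_elim (auto simp: indicator_def)
  qed
  also have "\<dots> = (\<integral>\<^sup>+\<omega>. indicator D \<omega> * ennreal (f \<omega>) \<partial>M)"
    using D by (intro nn_cond_exp_intg) auto
  also have "\<dots> = (\<integral>\<^sup>+\<omega>. ennreal (indicator D \<omega> * f \<omega>) \<partial>M)"
    by (intro nn_integral_cong) (auto simp: indicator_def)
  finally show "(\<integral>\<omega>. indicator D \<omega> * h \<omega> \<partial>M) = (\<integral>\<omega>. indicator D \<omega> * f \<omega> \<partial>M)"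
    using f(2) by (subst (1 2) integral_eq_nn_integral) (auto simp: h_def)
qed

lemma square_integrable_rv_cong:
  assumes "\<And>\<omega>. \<omega> \<in> space M \<Longrightarrow> f \<omega> = g \<omega>"
  shows "square_integrable_rv M f \<longleftrightarrow> square_integrable_rv M g"
  unfolding square_integrable_rv_def
  using assms by (intro conj_cong measurable_cong Bochner_Integration.integrable_cong) auto

lemma square_integrable_rv_add:
  fixes f g :: "'o \<Rightarrow> 'h::{real_normed_vector, second_countable_topology}"
  assumes f: "square_integrable_rv M f" and g: "square_integrable_rv M g"
  shows "square_integrable_rv M (\<lambda>\<omega>. f \<omega> + g \<omega>)"
proof -
  have [measurable]: "f \<in> borel_measurable M" "g \<in> borel_measurable M"
    using f g by (auto simp: square_integrable_rv_def)
  have "integrable M (\<lambda>\<omega>. (norm (f \<omega> + g \<omega>))\<^sup>2)"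
  proof (rule Bochner_Integration.integrable_bound)
    show "integrable M (\<lambda>\<omega>. 2 * (norm (f \<omega>))\<^sup>2 + 2 * (norm (g \<omega>))\<^sup>2)"
      using f g by (auto simp: square_integrable_rv_def)
    have "(norm (f \<omega> + g \<omega>))\<^sup>2 \<le> 2 * (norm (f \<omega>))\<^sup>2 + 2 * (norm (g \<omega>))\<^sup>2" for \<omega>
    proof -
      have "(norm (f \<omega> + g \<omega>))\<^sup>2 \<le> (norm (f \<omega>) + norm (g \<omega>))\<^sup>2"
        by (intro power_mono norm_triangle_ineq) auto
      also have "\<dots> \<le> 2 * (norm (f \<omega>))\<^sup>2 + 2 * (norm (g \<omega>))\<^sup>2"
        using sum_squares_bound[of "norm (f \<omega>)" "norm (g \<omega>)"] by (simp add: power2_sum)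
      finally show ?thesis .
    qed
    then show "AE \<omega> in M. norm ((norm (f \<omega> + g \<omega>))\<^sup>2) \<le> norm (2 * (norm (f \<omega>))\<^sup>2 + 2 * (norm (g \<omega>))\<^sup>2)"
      by (intro AE_I2) simp
  qed measurable
  then show ?thesis by (simp add: square_integrable_rv_def)
qed

lemma square_integrable_rv_bound:
  fixes f :: "'o \<Rightarrow> 'a::{real_normed_vector, second_countable_topology}"
    and g :: "'o \<Rightarrow> 'h::{real_normed_vector, second_countable_topology}"
  assumes f: "square_integrable_rv M f" and g: "g \<in> borel_measurable M"
    and le: "\<And>\<omega>. \<omega> \<in> space M \<Longrightarrow> norm (g \<omega>) \<le> C * norm (f \<omega>)"
  shows "square_integrable_rv M g"
proof -
  have "integrable M (\<lambda>\<omega>. (norm (g \<omega>))\<^sup>2)"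
  proof (rule Bochner_Integration.integrable_bound)
    show "integrable M (\<lambda>\<omega>. C\<^sup>2 * (norm (f \<omega>))\<^sup>2)"
      using f by (auto simp: square_integrable_rv_def)
    show "AE \<omega> in M. norm ((norm (g \<omega>))\<^sup>2) \<le> norm (C\<^sup>2 * (norm (f \<omega>))\<^sup>2)"
      using le by (intro AE_I2) (simp add: power_mult_distrib[symmetric] power_mono)
  qed (use g in measurable)
  then show ?thesis using g by (simp add: square_integrable_rv_def)
qed

lemma square_integrable_rv_bounded_linear:
  fixes f :: "'o \<Rightarrow> 'a::{real_normed_vector, second_countable_topology}"
    and T :: "'a \<Rightarrow> 'h::{real_normed_vector, second_countable_topology}"
  assumes f: "square_integrable_rv M f" and T: "bounded_linear T"
  shows "square_integrable_rv M (\<lambda>\<omega>. T (f \<omega>))"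
proof -
  obtain C where C: "\<And>v. norm (T v) \<le> norm v * C"
    using bounded_linear.bounded[OF T] by blast
  have "(\<lambda>\<omega>. T (f \<omega>)) \<in> borel_measurable M"
    using borel_measurable_continuous_on[OF linear_continuous_on[OF T], of f M] f
    by (simp add: square_integrable_rv_def)
  then show ?thesis
    by (rule square_integrable_rv_bound[OF f, where C = C]) (use C in \<open>simp add: mult.commute\<close>)
qed

lemma square_integrable_rv_scaleR:
  fixes f :: "'o \<Rightarrow> 'h::{real_normed_vector, second_countable_topology}"
  shows "square_integrable_rv M f \<Longrightarrow> square_integrable_rv M (\<lambda>\<omega>. c *\<^sub>R f \<omega>)"
  by (rule square_integrable_rv_bounded_linear[OF _ bounded_linear_scaleR_right])

lemma square_integrable_rv_diff:
  fixes f g :: "'o \<Rightarrow> 'h::{real_normed_vector, second_countable_topology}"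
  assumes "square_integrable_rv M f" and "square_integrable_rv M g"
  shows "square_integrable_rv M (\<lambda>\<omega>. f \<omega> - g \<omega>)"
  using square_integrable_rv_add[OF assms(1) square_integrable_rv_scaleR[OF assms(2), of "- 1"]] by simp

lemma (in finite_measure) square_integrable_rv_const:
  "square_integrable_rv M (\<lambda>_. c)"
  by (simp add: square_integrable_rv_def)

lemma square_integrable_rv_norm_mult:
  fixes f :: "'o \<Rightarrow> 'a::{real_normed_vector, second_countable_topology}"
    and g :: "'o \<Rightarrow> 'b::{real_normed_vector, second_countable_topology}"
  assumes f: "square_integrable_rv M f" and g: "square_integrable_rv M g"
  shows "integrable M (\<lambda>\<omega>. norm (f \<omega>) * norm (g \<omega>))"
proof -
  have [measurable]: "f \<in> borel_measurable M" "g \<in> borel_measurable M"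
    using f g by (auto simp: square_integrable_rv_def)
  show ?thesis
  proof (rule Bochner_Integration.integrable_bound)
    show "integrable M (\<lambda>\<omega>. (norm (f \<omega>))\<^sup>2 + (norm (g \<omega>))\<^sup>2)"
      using f g by (auto simp: square_integrable_rv_def)
    have "norm (f \<omega>) * norm (g \<omega>) \<le> (norm (f \<omega>))\<^sup>2 + (norm (g \<omega>))\<^sup>2" for \<omega>
    proof -
      have "0 \<le> norm (f \<omega>) * norm (g \<omega>)" by simp
      then show ?thesis
        using sum_squares_bound[of "norm (f \<omega>)" "norm (g \<omega>)"] by linarith
    qed
    then show "AE \<omega> in M. norm (norm (f \<omega>) * norm (g \<omega>)) \<le> norm ((norm (f \<omega>))\<^sup>2 + (norm (g \<omega>))\<^sup>2)"
      by (intro AE_I2) simp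
  qed measurable
qed

lemma square_integrable_rv_inner:
  fixes f g :: "'o \<Rightarrow> 'h::{real_inner, second_countable_topology}"
  assumes f: "square_integrable_rv M f" and g: "square_integrable_rv M g"
  shows "integrable M (\<lambda>\<omega>. f \<omega> \<bullet> g \<omega>)"
proof -
  have fm: "f \<in> borel_measurable M" and gm: "g \<in> borel_measurable M"
    using f g unfolding square_integrable_rv_def by blast+
  show ?thesis
  proof (rule Bochner_Integration.integrable_bound)
    show "integrable M (\<lambda>\<omega>. norm (f \<omega>) * norm (g \<omega>))"
      by (rule square_integrable_rv_norm_mult[OF f g])
    show "(\<lambda>\<omega>. f \<omega> \<bullet> g \<omega>) \<in> borel_measurable M" by (rule borel_measurable_inner[OF fm gm])
    show "AE \<omega> in M. norm (f \<omega> \<bullet> g \<omega>) \<le> norm (norm (f \<omega>) * norm (g \<omega>))"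
      by (intro AE_I2) (simp add: Cauchy_Schwarz_ineq2)
  qed
qed

lemma (in finite_measure) integrable_of_square_integrable_rv:
  fixes f :: "'a \<Rightarrow> 'h::{banach, second_countable_topology}"
  assumes f: "square_integrable_rv M f"
  shows "integrable M f"
proof (rule Bochner_Integration.integrable_bound)
  show "integrable M (\<lambda>\<omega>. norm (f \<omega>) * norm (1::real))"
    by (rule square_integrable_rv_norm_mult[OF f square_integrable_rv_const])
  show "f \<in> borel_measurable M" using f unfolding square_integrable_rv_def by (rule conjunct1)
  show "AE \<omega> in M. norm (f \<omega>) \<le> norm (norm (f \<omega>) * norm (1::real))"
    by (rule AE_I2) simp
qed

section \<open>The stochastic iteration\<close>

text \<open>
  The iteration over an arbitrary filtration to which it is adapted.  The noise is centred on every event of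
  the past, which is how the vector-valued conditional expectation \<open>E[r\<^sub>n | F\<^sub>n] = B w\<^sub>n\<close> enters the proof.
\<close>

locale stochastic_forward_backward =
  preconditioned_inclusion U V B A \<beta> \<mu> \<kappa> K L + filtered_prob_space M F
  for U V B :: "'h::{real_inner, banach, second_countable_topology} \<Rightarrow> 'h"
    and A :: "'h \<Rightarrow> 'h set" and \<beta> \<mu> \<kappa> K L :: real
    and M :: "'o measure" and F :: "nat \<Rightarrow> 'o measure" +
  fixes \<epsilon> :: real and \<gamma> lam \<alpha> :: "nat \<Rightarrow> real" and r x w p :: "nat \<Rightarrow> 'o \<Rightarrow> 'h"
  assumes \<epsilon>: "0 < \<epsilon>"
    and \<gamma>: "\<And>n. \<epsilon> \<le> \<gamma> n" "\<And>n. \<gamma> n \<le> (2 - \<epsilon>) * \<beta>"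
    and lam: "\<And>n. \<epsilon> \<le> lam n" "\<And>n. lam n \<le> 1"
    and \<alpha>: "\<And>n. 0 \<le> \<alpha> n" "\<And>n. \<alpha> n \<le> 1" "summable \<alpha>"
    and x_adapted: "\<And>n. x n \<in> borel_measurable (F n)"
    and r_sq: "\<And>n. square_integrable_rv M (r n)"
    and x0_sq: "square_integrable_rv M (x 0)"
    and w_eq: "\<And>n \<omega>. \<omega> \<in> space M \<Longrightarrow> w n \<omega> = x n \<omega> + \<alpha> n *\<^sub>R (x n \<omega> - prev x n \<omega>)"
    and p_res: "\<And>n \<omega>. \<omega> \<in> space M \<Longrightarrow>
      p n \<omega> \<in> resolvent (scaled_op (\<gamma> n) U A) (w n \<omega> - \<gamma> n *\<^sub>R U (r n \<omega>))"
    and x_Suc: "\<And>n \<omega>. \<omega> \<in> space M \<Longrightarrow> x (Suc n) \<omega> = x n \<omega> + lam n *\<^sub>R (p n \<omega> - x n \<omega>)"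
    and noise_mean: "\<And>n D. D \<in> sets (F n) \<Longrightarrow>
      (\<integral>\<omega>. indicator D \<omega> *\<^sub>R (r n \<omega> - B (w n \<omega>)) \<partial>M) = 0"
    and noise_var: "AE \<omega> in M. (\<Sum>n. nn_cond_exp M (F n)
      (\<lambda>\<omega>'. ennreal ((norm (r n \<omega>' - B (w n \<omega>')))\<^sup>2)) \<omega>) < \<infinity>"
    and increments: "AE \<omega> in M. bdd_above (range (\<lambda>n. (norm (x n \<omega> - prev x n \<omega>))\<^sup>2))"
begin

lemma \<gamma>_bounds: "0 \<le> \<gamma> n" "\<gamma> n \<le> 2 * \<beta>" "\<epsilon> * (\<epsilon> * \<beta>) \<le> \<gamma> n * (2 * \<beta> - \<gamma> n)"
proof -
  show "0 \<le> \<gamma> n" using \<epsilon> \<gamma>(1)[of n] by simp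
  have gap: "\<epsilon> * \<beta> \<le> 2 * \<beta> - \<gamma> n" using \<gamma>(2)[of n] by (simp add: algebra_simps)
  moreover have "0 \<le> \<epsilon> * \<beta>" using \<epsilon> \<beta>_pos by simp
  ultimately show "\<gamma> n \<le> 2 * \<beta>" by linarith
  show "\<epsilon> * (\<epsilon> * \<beta>) \<le> \<gamma> n * (2 * \<beta> - \<gamma> n)"
    using gap \<gamma>(1)[of n] \<epsilon> \<beta>_pos by (intro mult_mono) auto
qed

lemma lam_bounds: "0 \<le> lam n" "lam n \<noteq> 0"
  using \<epsilon> lam(1)[of n] by auto

lemma prev_adapted: "prev x n \<in> borel_measurable (F n)"
proof (cases n)
  case 0
  have "prev x 0 = x 0" by (simp add: prev_def)
  then show ?thesis using x_adapted[of 0] 0 by simp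
next
  case (Suc m)
  have "prev x (Suc m) = x m" by (simp add: prev_def)
  then show ?thesis using measurable_F_mono[OF _ x_adapted[of m], of "Suc m"] Suc by simp
qed

lemma increment_adapted: "(\<lambda>\<omega>. x n \<omega> - prev x n \<omega>) \<in> borel_measurable (F n)"
  by (intro borel_measurable_diff x_adapted prev_adapted)

lemma w_adapted: "w n \<in> borel_measurable (F n)"
proof -
  have "(\<lambda>\<omega>. x n \<omega> + \<alpha> n *\<^sub>R (x n \<omega> - prev x n \<omega>)) \<in> borel_measurable (F n)"
    by (intro borel_measurable_add borel_measurable_scaleR borel_measurable_const x_adapted
        increment_adapted)
  then show ?thesis using w_eq by (subst measurable_cong[where M = "F n"]) auto
qed

lemma B_adapted: "(\<lambda>\<omega>. B (w n \<omega>)) \<in> borel_measurable (F n)"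
  by (rule borel_measurable_continuous_on[OF B_continuous w_adapted])

lemma measurable_M: "f \<in> borel_measurable (F n) \<Longrightarrow> f \<in> borel_measurable M"
  by (rule measurable_from_subalg[OF subalg])

abbreviation noise :: "nat \<Rightarrow> 'o \<Rightarrow> 'h" where
  "noise n \<equiv> \<lambda>\<omega>. r n \<omega> - B (w n \<omega>)"

text \<open>
  The vector that multiplies the noise in the cross term; it depends on the past only.
\<close>

abbreviation forward_gap :: "'h \<Rightarrow> nat \<Rightarrow> 'o \<Rightarrow> 'h" where
  "forward_gap y n \<equiv> \<lambda>\<omega>. w n \<omega> - y - \<gamma> n *\<^sub>R U (B (w n \<omega>) - B y)"

text \<open>
  The backward residual: it vanishes when \<open>p\<^sub>n = w\<^sub>n\<close> and \<open>r\<^sub>n = B y\<close>.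
\<close>

abbreviation backward_gap :: "'h \<Rightarrow> nat \<Rightarrow> 'o \<Rightarrow> 'h" where
  "backward_gap y n \<equiv> \<lambda>\<omega>. w n \<omega> - p n \<omega> - \<gamma> n *\<^sub>R U (r n \<omega> - B y)"

text \<open>
  The coefficients of \<open>iteration_step\<close> are replaced by constants that do not depend on \<open>n\<close>, again except in
  the cross term.
\<close>

lemma process_step:
  assumes y: "y \<in> zeros" and \<omega>: "\<omega> \<in> space M"
  shows "Q (x (Suc n) \<omega> - y)
      + \<epsilon> * (\<epsilon> * (\<epsilon> * \<beta>) * \<mu> * (norm (B (w n \<omega>) - B y))\<^sup>2 + \<kappa> * (norm (backward_gap y n \<omega>))\<^sup>2)
    \<le> (1 + \<alpha> n) * Q (x n \<omega> - y) + 2 * \<alpha> n * Q (x n \<omega> - prev x n \<omega>)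
      + (2 * \<beta>)\<^sup>2 * K * (norm (noise n \<omega>))\<^sup>2 - 2 * lam n * \<gamma> n * (forward_gap y n \<omega> \<bullet> noise n \<omega>)"
    (is "_ + \<epsilon> * (\<epsilon> * (\<epsilon> * \<beta>) * \<mu> * ?b + ?m) \<le> _")
proof -
  have "\<epsilon> * (\<epsilon> * \<beta>) * (\<mu> * ?b) \<le> \<gamma> n * (2 * \<beta> - \<gamma> n) * (\<mu> * ?b)"
    using \<gamma>_bounds(3)[of n] \<mu>(1) by (intro mult_right_mono) auto
  then have "\<epsilon> * (\<epsilon> * \<beta>) * \<mu> * ?b + ?m \<le> \<gamma> n * (2 * \<beta> - \<gamma> n) * \<mu> * ?b + ?m"
    by (simp add: mult.assoc)
  moreover have "0 \<le> \<epsilon> * (\<epsilon> * \<beta>) * \<mu> * ?b + ?m" using \<epsilon> \<beta>_pos \<mu>(1) \<kappa>(1) by simp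
  ultimately have "\<epsilon> * (\<epsilon> * (\<epsilon> * \<beta>) * \<mu> * ?b + ?m) \<le> lam n * (\<gamma> n * (2 * \<beta> - \<gamma> n) * \<mu> * ?b + ?m)"
    using \<epsilon> lam(1)[of n] by (intro mult_mono) auto
  moreover have "(\<gamma> n)\<^sup>2 * K * (norm (noise n \<omega>))\<^sup>2 \<le> (2 * \<beta>)\<^sup>2 * K * (norm (noise n \<omega>))\<^sup>2"
    using \<gamma>_bounds(1,2)[of n] K(1) by (intro mult_right_mono power_mono) auto
  moreover note iteration_step[OF y \<alpha>(1)[of n] \<alpha>(2)[of n] \<gamma>_bounds(1)[of n] \<gamma>_bounds(2)[of n]
      lam_bounds(1)[of n] lam(2)[of n] w_eq[OF \<omega>] p_res[OF \<omega>]]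
  ultimately show ?thesis unfolding x_Suc[OF \<omega>] by linarith
qed

lemma square_integrable_B:
  assumes "square_integrable_rv M f"
  shows "square_integrable_rv M (\<lambda>\<omega>. B (f \<omega>))"
proof -
  have f: "f \<in> borel_measurable M" using assms unfolding square_integrable_rv_def by blast
  have "square_integrable_rv M (\<lambda>\<omega>. B (f \<omega>) - B 0)"
  proof (rule square_integrable_rv_bound[OF assms])
    show "(\<lambda>\<omega>. B (f \<omega>) - B 0) \<in> borel_measurable M"
      by (intro borel_measurable_diff borel_measurable_const borel_measurable_continuous_on[OF B_continuous f])
    show "norm (B (f \<omega>) - B 0) \<le> 1 / (\<beta> * \<mu>) * norm (f \<omega>)" for \<omega>
      using B_lipschitz[of "f \<omega>" 0] by simp
  qed
  from square_integrable_rv_add[OF this square_integrable_rv_const[of "B 0"]] show ?thesis by simp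
qed

lemma square_integrable_U:
  "square_integrable_rv M f \<Longrightarrow> square_integrable_rv M (\<lambda>\<omega>. U (f \<omega>))"
  by (rule square_integrable_rv_bounded_linear[OF _ U_lin])

lemmas square_integrable_intros =
  square_integrable_rv_add square_integrable_rv_diff square_integrable_rv_scaleR
  square_integrable_rv_const square_integrable_B square_integrable_U r_sq

lemma square_integrable_w:
  assumes "square_integrable_rv M (x n)" "square_integrable_rv M (prev x n)"
  shows "square_integrable_rv M (w n)"
proof -
  have "square_integrable_rv M (\<lambda>\<omega>. x n \<omega> + \<alpha> n *\<^sub>R (x n \<omega> - prev x n \<omega>))"
    by (intro square_integrable_intros assms)
  moreover have "square_integrable_rv M (w n) \<longleftrightarrow>
      square_integrable_rv M (\<lambda>\<omega>. x n \<omega> + \<alpha> n *\<^sub>R (x n \<omega> - prev x n \<omega>))"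
    by (rule square_integrable_rv_cong) (rule w_eq)
  ultimately show ?thesis by (rule iffD2[rotated])
qed

lemma integrable_Q:
  assumes "square_integrable_rv M f"
  shows "integrable M (\<lambda>\<omega>. Q (f \<omega>))"
  unfolding Q_def
  by (rule square_integrable_rv_inner[OF assms square_integrable_rv_bounded_linear[OF assms V_lin]])

lemma integrable_norm_sq:
  "square_integrable_rv M f \<Longrightarrow> integrable M (\<lambda>\<omega>. (norm (f \<omega>))\<^sup>2)"
  unfolding square_integrable_rv_def by blast

text \<open>
  The one-step inequality bounds \<open>Q (x\<^sub>n\<^sub>+\<^sub>1 - y)\<close> by an integrable function, so square integrability
  propagates along the iteration.
\<close>

lemma square_integrable_Suc:
  assumes y: "y \<in> zeros"
    and sq: "square_integrable_rv M (x n)" "square_integrable_rv M (prev x n)"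
  shows "square_integrable_rv M (x (Suc n))"
proof -
  note sq_w = square_integrable_w[OF sq]
  define R where "R \<omega> = (1 + \<alpha> n) * Q (x n \<omega> - y) + 2 * \<alpha> n * Q (x n \<omega> - prev x n \<omega>)
      + (2 * \<beta>)\<^sup>2 * K * (norm (noise n \<omega>))\<^sup>2 - 2 * lam n * \<gamma> n * (forward_gap y n \<omega> \<bullet> noise n \<omega>)" for \<omega>
  have "integrable M R"
    unfolding R_def
    by (intro Bochner_Integration.integrable_add Bochner_Integration.integrable_diff
        integrable_mult_right integrable_Q integrable_norm_sq square_integrable_rv_inner
        square_integrable_intros sq sq_w)
  have meas: "x (Suc n) \<in> borel_measurable M" by (rule measurable_M[OF x_adapted])
  have "integrable M (\<lambda>\<omega>. (norm (x (Suc n) \<omega> - y))\<^sup>2)"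
  proof (rule Bochner_Integration.integrable_bound)
    show "integrable M (\<lambda>\<omega>. R \<omega> / \<kappa>)" using \<open>integrable M R\<close> by simp
    show "(\<lambda>\<omega>. (norm (x (Suc n) \<omega> - y))\<^sup>2) \<in> borel_measurable M"
      using meas by measurable
    show "AE \<omega> in M. norm ((norm (x (Suc n) \<omega> - y))\<^sup>2) \<le> norm (R \<omega> / \<kappa>)"
    proof (rule AE_I2)
      fix \<omega> assume \<omega>: "\<omega> \<in> space M"
      have "0 \<le> \<epsilon> * (\<epsilon> * (\<epsilon> * \<beta>) * \<mu> * (norm (B (w n \<omega>) - B y))\<^sup>2 + \<kappa> * (norm (backward_gap y n \<omega>))\<^sup>2)"
        using \<epsilon> \<beta>_pos \<mu>(1) \<kappa>(1) by simp
      then have "Q (x (Suc n) \<omega> - y) \<le> R \<omega>"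
        using process_step[OF y \<omega>, of n] unfolding R_def by linarith
      then have "\<kappa> * (norm (x (Suc n) \<omega> - y))\<^sup>2 \<le> R \<omega>"
        using Q_lower order_trans by blast
      then have "(norm (x (Suc n) \<omega> - y))\<^sup>2 \<le> R \<omega> / \<kappa>"
        using \<kappa>(1) by (simp add: pos_le_divide_eq mult.commute)
      from order_trans[OF this abs_ge_self]
      show "norm ((norm (x (Suc n) \<omega> - y))\<^sup>2) \<le> norm (R \<omega> / \<kappa>)"
        by (simp only: real_norm_def abs_of_nonneg[OF zero_le_power2])
    qed
  qed
  then have "square_integrable_rv M (\<lambda>\<omega>. x (Suc n) \<omega> - y)"
    using meas unfolding square_integrable_rv_def
    by (intro conjI borel_measurable_diff borel_measurable_const)
  from square_integrable_rv_add[OF this square_integrable_rv_const[of y]] show ?thesis by simp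
qed

lemma square_integrable_process:
  assumes "zeros \<noteq> {}"
  shows "square_integrable_rv M (x n) \<and> square_integrable_rv M (prev x n)"
proof (induction n)
  case 0
  have "prev x 0 = x 0" by (simp add: prev_def)
  then show ?case using x0_sq by simp
next
  case (Suc n)
  have "prev x (Suc n) = x n" by (simp add: prev_def)
  moreover obtain y where "y \<in> zeros" using assms by blast
  ultimately show ?case using square_integrable_Suc[of y n] Suc by simp
qed

text \<open>
  Including the squared noise makes its summability along almost every path a part of the conclusion of
  the Robbins-Siegmund theorem.
\<close>

definition residual :: "'h \<Rightarrow> nat \<Rightarrow> 'o \<Rightarrow> real" where
  "residual y n \<omega> =
     \<epsilon> * (\<epsilon> * (\<epsilon> * \<beta>) * \<mu> * (norm (B (w n \<omega>) - B y))\<^sup>2 + \<kappa> * (norm (backward_gap y n \<omega>))\<^sup>2)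
       + (norm (noise n \<omega>))\<^sup>2"

text \<open>
  The decisive application of the Robbins-Siegmund theorem.  The compensator \<open>\<eta>\<close> consists of the inertial term
  and of the conditional variance \<open>v\<close> of the noise; over events of the past, \<open>v\<close> has the same integral
  as the squared noise, and the cross term integrates to zero.
\<close>

theorem quasi_fejer:
  assumes y: "y \<in> zeros"
  shows "AE \<omega> in M. convergent (\<lambda>n. Q (x n \<omega> - y)) \<and> summable (\<lambda>n. residual y n \<omega>)"
proof -
  have sq: "square_integrable_rv M (x n)" "square_integrable_rv M (prev x n)" for n
    using square_integrable_process y by blast+
  have sq_w: "square_integrable_rv M (w n)" for n by (rule square_integrable_w[OF sq])
  have sq_p: "square_integrable_rv M (p n)" for n
  proof -
    have "square_integrable_rv M (\<lambda>\<omega>. x n \<omega> + (1 / lam n) *\<^sub>R (x (Suc n) \<omega> - x n \<omega>))"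
      by (intro square_integrable_intros sq)
    moreover have "square_integrable_rv M (p n) \<longleftrightarrow>
        square_integrable_rv M (\<lambda>\<omega>. x n \<omega> + (1 / lam n) *\<^sub>R (x (Suc n) \<omega> - x n \<omega>))"
      by (rule square_integrable_rv_cong) (use x_Suc lam_bounds(2)[of n] in simp)
    ultimately show ?thesis by (rule iffD2[rotated])
  qed
  have noise_sq: "square_integrable_rv M (noise n)" for n by (intro square_integrable_intros sq_w)
  have sub: "sigma_finite_subalgebra M (F n)" for n
    by (intro finite_measure_subalgebra_is_sigma_finite finite_measure_subalgebra.intro
        finite_measure_subalgebra_axioms.intro finite_measure_axioms subalg)
  define v where "v n \<omega> = enn2real (nn_cond_exp M (F n) (\<lambda>\<omega>. ennreal ((norm (noise n \<omega>))\<^sup>2)) \<omega>)" for n \<omega>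
  note version = sigma_finite_subalgebra.real_version_nn_cond_exp
    [OF sub integrable_norm_sq[OF noise_sq] zero_le_power2]
  have v_adapted: "v n \<in> borel_measurable (F n)" and v_int: "integrable M (v n)" for n
    unfolding v_def[abs_def] by (rule version)+
  have v_mean: "(\<integral>\<omega>. indicator D \<omega> * v n \<omega> \<partial>M) = (\<integral>\<omega>. indicator D \<omega> * (norm (noise n \<omega>))\<^sup>2 \<partial>M)"
    if "D \<in> sets (F n)" for n D
    unfolding v_def using that by (rule version)
  \<comment> \<open>The summand 1 pays for the squared noise contained in the residual.\<close>
  define c where "c = (2 * \<beta>)\<^sup>2 * K + 1"
  have "0 \<le> c" using K(1) by (simp add: c_def)
  define \<eta> where "\<eta> n \<omega> = 2 * \<alpha> n * Q (x n \<omega> - prev x n \<omega>) + c * v n \<omega>" for n \<omega>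
  show ?thesis
  proof (rule robbins_siegmund[where \<alpha> = \<alpha> and \<eta> = \<eta>])
    have Q_cont: "continuous_on UNIV Q"
      unfolding Q_def[abs_def] by (intro continuous_intros linear_continuous_on V_lin)
    show "(\<lambda>\<omega>. Q (x n \<omega> - y)) \<in> borel_measurable (F n)" for n
      by (rule borel_measurable_continuous_on[OF Q_cont])
         (intro borel_measurable_diff borel_measurable_const x_adapted)
    have "(\<lambda>\<omega>. Q (x n \<omega> - prev x n \<omega>)) \<in> borel_measurable (F n)" for n
      by (rule borel_measurable_continuous_on[OF Q_cont increment_adapted])
    then show "\<eta> n \<in> borel_measurable (F n)" for n
      unfolding \<eta>_def[abs_def] 
      by (intro borel_measurable_add borel_measurable_times borel_measurable_const v_adapted)
    show "integrable M (\<lambda>\<omega>. Q (x n \<omega> - y))" for n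
      by (intro integrable_Q square_integrable_intros sq)
    show \<eta>_int: "integrable M (\<eta> n)" for n
      unfolding \<eta>_def[abs_def]
      by (intro Bochner_Integration.integrable_add integrable_mult_right integrable_Q
          square_integrable_intros sq v_int)
    show res_int: "integrable M (residual y n)" for n
      unfolding residual_def[abs_def]
      by (intro Bochner_Integration.integrable_add integrable_mult_right integrable_norm_sq
          square_integrable_intros sq_w sq_p)
    show "0 \<le> residual y n \<omega>" for n \<omega>
      using \<epsilon> \<beta>_pos \<mu>(1) \<kappa>(1) by (simp add: residual_def)
    show "0 \<le> \<eta> n \<omega>" for n \<omega>
      using \<alpha>(1) \<open>0 \<le> c\<close> Q_nonneg by (simp add: \<eta>_def v_def)
    show "(\<integral>\<omega>. indicator D \<omega> * (Q (x (Suc n) \<omega> - y) - (1 + \<alpha> n) * Q (x n \<omega> - y)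
        + residual y n \<omega> - \<eta> n \<omega>) \<partial>M) \<le> 0" if D: "D \<in> sets (F n)" for n D
    proof -
      have DM: "D \<in> sets M" using D sets_F by blast
      have ind: "integrable M (\<lambda>\<omega>. indicator D \<omega> * f \<omega>)" if "integrable M f" for f :: "'o \<Rightarrow> real"
        using integrable_real_mult_indicator[OF DM that] by (simp add: mult.commute)
      have gap_sq: "square_integrable_rv M (forward_gap y n)"
        by (intro square_integrable_intros sq_w)
      have orth: "(\<integral>\<omega>. indicator D \<omega> * (forward_gap y n \<omega> \<bullet> noise n \<omega>) \<partial>M) = 0"
      proof -
        have gap_meas: "(\<lambda>\<omega>. indicator D \<omega> *\<^sub>R forward_gap y n \<omega>) \<in> borel_measurable (F n)"
          by (intro borel_measurable_scaleR borel_measurable_indicator D borel_measurable_diff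
              borel_measurable_const w_adapted
              borel_measurable_continuous_on[OF linear_continuous_on[OF U_lin]] B_adapted)
        have "integrable M (\<lambda>\<omega>. indicator D \<omega> * (norm (forward_gap y n \<omega>) * norm (noise n \<omega>)))"
          by (intro ind square_integrable_rv_norm_mult gap_sq noise_sq)
        then have "integrable M (\<lambda>\<omega>. norm (indicator D \<omega> *\<^sub>R forward_gap y n \<omega>) * norm (noise n \<omega>))"
          by (simp add: mult.assoc)
        from integral_inner_eq_0[OF subalg gap_meas
            integrable_of_square_integrable_rv[OF noise_sq] noise_mean this]
        show ?thesis by simp
      qed
      define k where "k = 2 * lam n * \<gamma> n"
      have int1: "integrable M (\<lambda>\<omega>. indicator D \<omega> * (norm (noise n \<omega>))\<^sup>2)"
        by (intro ind integrable_norm_sq noise_sq)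
      have int2: "integrable M (\<lambda>\<omega>. indicator D \<omega> * v n \<omega>)" by (intro ind v_int)
      have int3: "integrable M (\<lambda>\<omega>. indicator D \<omega> * (forward_gap y n \<omega> \<bullet> noise n \<omega>))"
        by (intro ind square_integrable_rv_inner gap_sq noise_sq)
      have "(\<integral>\<omega>. indicator D \<omega> * (Q (x (Suc n) \<omega> - y) - (1 + \<alpha> n) * Q (x n \<omega> - y)
          + residual y n \<omega> - \<eta> n \<omega>) \<partial>M)
        \<le> (\<integral>\<omega>. c * (indicator D \<omega> * (norm (noise n \<omega>))\<^sup>2) - c * (indicator D \<omega> * v n \<omega>)
            - k * (indicator D \<omega> * (forward_gap y n \<omega> \<bullet> noise n \<omega>)) \<partial>M)"
      proof (rule integral_mono)
        fix \<omega> assume \<omega>: "\<omega> \<in> space M"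
        have "Q (x (Suc n) \<omega> - y) - (1 + \<alpha> n) * Q (x n \<omega> - y) + residual y n \<omega> - \<eta> n \<omega>
          \<le> c * (norm (noise n \<omega>))\<^sup>2 - c * v n \<omega> - k * (forward_gap y n \<omega> \<bullet> noise n \<omega>)"
          using process_step[OF y \<omega>, of n]
          unfolding residual_def \<eta>_def c_def k_def distrib_right mult_1_left by linarith
        then show "indicator D \<omega> * (Q (x (Suc n) \<omega> - y) - (1 + \<alpha> n) * Q (x n \<omega> - y)
            + residual y n \<omega> - \<eta> n \<omega>)
          \<le> c * (indicator D \<omega> * (norm (noise n \<omega>))\<^sup>2) - c * (indicator D \<omega> * v n \<omega>)
            - k * (indicator D \<omega> * (forward_gap y n \<omega> \<bullet> noise n \<omega>))"
          by (cases "\<omega> \<in> D") simp_all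
      next
        show "integrable M (\<lambda>\<omega>. indicator D \<omega> * (Q (x (Suc n) \<omega> - y) - (1 + \<alpha> n) * Q (x n \<omega> - y)
            + residual y n \<omega> - \<eta> n \<omega>))"
          by (intro ind Bochner_Integration.integrable_add Bochner_Integration.integrable_diff
              integrable_mult_right integrable_Q square_integrable_intros sq res_int \<eta>_int)
        show "integrable M (\<lambda>\<omega>. c * (indicator D \<omega> * (norm (noise n \<omega>))\<^sup>2) - c * (indicator D \<omega> * v n \<omega>)
            - k * (indicator D \<omega> * (forward_gap y n \<omega> \<bullet> noise n \<omega>)))"
          by (intro Bochner_Integration.integrable_diff integrable_mult_right int1 int2 int3)
      qed
      also have "\<dots> = c * (\<integral>\<omega>. indicator D \<omega> * (norm (noise n \<omega>))\<^sup>2 \<partial>M) - c * (\<integral>\<omega>. indicator D \<omega> * v n \<omega> \<partial>M)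
          - k * (\<integral>\<omega>. indicator D \<omega> * (forward_gap y n \<omega> \<bullet> noise n \<omega>) \<partial>M)"
        by (simp only: Bochner_Integration.integral_diff integral_mult_right_zero
            Bochner_Integration.integrable_diff integrable_mult_right int1 int2 int3)
      also have "\<dots> = 0" unfolding orth v_mean[OF D] by simp
      finally show ?thesis .
    qed
    show "AE \<omega> in M. summable (\<lambda>n. \<eta> n \<omega>)"
      using noise_var increments
    proof eventually_elim
      case (elim \<omega>)
      let ?n = "\<lambda>n. nn_cond_exp M (F n) (\<lambda>\<omega>. ennreal ((norm (noise n \<omega>))\<^sup>2)) \<omega>"
      have fin: "(\<Sum>n. ?n n) \<noteq> \<top>" using elim(1) by simp
      have "?n n < \<top>" for n
      proof -
        have "?n n \<le> (\<Sum>n. ?n n)" using sum_le_suminf[of ?n "{n}"] by simp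
        then show ?thesis using fin by (simp add: less_top[symmetric] neq_top_trans)
      qed
      then have "ennreal (v n \<omega>) = ?n n" for n by (simp add: v_def)
      then have "summable (\<lambda>n. v n \<omega>)"
        using fin by (intro summable_suminf_not_top) (simp_all add: v_def)
      moreover obtain C where C: "\<And>n. (norm (x n \<omega> - prev x n \<omega>))\<^sup>2 \<le> C"
        using elim(2) by (auto simp: bdd_above_def)
      have "summable (\<lambda>n. 2 * \<alpha> n * Q (x n \<omega> - prev x n \<omega>))"
      proof (rule summable_comparison_test'[of _ 0])
        show "summable (\<lambda>n. (2 * L * C) * \<alpha> n)" by (intro summable_mult \<alpha>(3))
        fix n
        have "Q (x n \<omega> - prev x n \<omega>) \<le> L * C"
          using Q_upper[of "x n \<omega> - prev x n \<omega>"] mult_left_mono[OF C[of n], of L] L(1) by linarith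
        then have "2 * \<alpha> n * Q (x n \<omega> - prev x n \<omega>) \<le> 2 * \<alpha> n * (L * C)"
          using \<alpha>(1)[of n] by (intro mult_left_mono) auto
        then show "norm (2 * \<alpha> n * Q (x n \<omega> - prev x n \<omega>)) \<le> (2 * L * C) * \<alpha> n"
          using \<alpha>(1)[of n] Q_nonneg[of "x n \<omega> - prev x n \<omega>"] by (simp add: mult_ac abs_mult)
      qed
      ultimately show ?case unfolding \<eta>_def by (intro summable_add summable_mult)
    qed
  qed (rule Q_nonneg \<alpha>)+
qed

text \<open>
  The exceptional null set of \<open>quasi_fejer\<close> depends on the zero, so it is applied to a countable dense
  set of zeros only; \<open>pathwise_convergence\<close> reaches the others.
\<close>

lemma AE_weak_limit:
  assumes "zeros \<noteq> {}"
  shows "AE \<omega> in M. \<exists>l\<in>zeros. weakly_tendsto (\<lambda>n. x n \<omega>) l \<and> (\<lambda>n. B (x n \<omega>)) \<longlonglongrightarrow> B l"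
proof -
  obtain y where y: "y \<in> zeros" using assms by blast
  obtain D where D: "countable D" "D \<subseteq> zeros" "zeros \<subseteq> closure D" using separable by blast
  have "AE \<omega> in M. \<forall>d\<in>D. convergent (\<lambda>n. Q (x n \<omega> - d))"
  proof (rule AE_ball_countable'[OF _ D(1)])
    fix d assume "d \<in> D"
    then have "d \<in> zeros" using D(2) by blast
    from quasi_fejer[OF this] show "AE \<omega> in M. convergent (\<lambda>n. Q (x n \<omega> - d))" by eventually_elim simp
  qed
  then show ?thesis
    using quasi_fejer[OF y] increments AE_space
  proof eventually_elim
    case (elim \<omega>)
    note \<omega> = elim(4)
    have res0: "(\<lambda>n. residual y n \<omega>) \<longlonglongrightarrow> 0" using elim(2) by (intro summable_LIMSEQ_zero) simp
    have null: "a \<longlonglongrightarrow> 0" if "c > 0" and le: "\<And>n. c * (norm (a n))\<^sup>2 \<le> residual y n \<omega>"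
      for a :: "nat \<Rightarrow> 'h" and c
    proof -
      have "(\<lambda>n. (norm (a n))\<^sup>2) \<longlonglongrightarrow> 0"
      proof (rule Lim_null_comparison[OF always_eventually[OF allI]])
        show "norm ((norm (a n))\<^sup>2) \<le> residual y n \<omega> / c" for n
          using le[of n] \<open>c > 0\<close> by (simp add: pos_le_divide_eq mult.commute)
        show "(\<lambda>n. residual y n \<omega> / c) \<longlonglongrightarrow> 0" using res0 by (rule tendsto_divide_zero)
      qed
      then have "(\<lambda>n. sqrt ((norm (a n))\<^sup>2)) \<longlonglongrightarrow> sqrt 0" by (rule tendsto_real_sqrt)
      then show ?thesis by (simp add: tendsto_norm_zero_iff)
    qed
    show ?case
    proof (rule pathwise_convergence[OF \<epsilon> \<gamma> p_res[OF \<omega>] y])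
      show "(\<lambda>n. B (w n \<omega>) - B y) \<longlonglongrightarrow> 0"
        by (rule null[of "\<epsilon> * (\<epsilon> * (\<epsilon> * \<beta>) * \<mu>)"])
           (use \<epsilon> \<beta>_pos \<mu>(1) \<kappa>(1) in \<open>simp_all add: residual_def distrib_left\<close>)
      show "(\<lambda>n. w n \<omega> - p n \<omega> - \<gamma> n *\<^sub>R U (r n \<omega> - B y)) \<longlonglongrightarrow> 0"
        by (rule null[of "\<epsilon> * \<kappa>"])
           (use \<epsilon> \<beta>_pos \<mu>(1) \<kappa>(1) in \<open>simp_all add: residual_def distrib_left\<close>)
      show "(\<lambda>n. r n \<omega> - B (w n \<omega>)) \<longlonglongrightarrow> 0"
        by (rule null[of 1])
           (use \<epsilon> \<beta>_pos \<mu>(1) \<kappa>(1) in \<open>simp_all add: residual_def distrib_left\<close>)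
      obtain C where C: "\<And>n. (norm (x n \<omega> - prev x n \<omega>))\<^sup>2 \<le> C"
        using elim(3) by (auto simp: bdd_above_def)
      show "(\<lambda>n. w n \<omega> - x n \<omega>) \<longlonglongrightarrow> 0"
      proof (rule Lim_null_comparison[OF always_eventually[OF allI]])
        show "norm (w n \<omega> - x n \<omega>) \<le> \<alpha> n * sqrt C" for n
        proof -
          have "norm (x n \<omega> - prev x n \<omega>) \<le> sqrt C" by (rule real_le_rsqrt[OF C])
          then show ?thesis using \<alpha>(1)[of n] by (simp add: w_eq[OF \<omega>] mult_left_mono)
        qed
        show "(\<lambda>n. \<alpha> n * sqrt C) \<longlonglongrightarrow> 0"
          using tendsto_mult_left_zero[OF summable_LIMSEQ_zero[OF \<alpha>(3)]] .
      qed
      show "convergent (\<lambda>n. Q (x n \<omega> - d))" if "d \<in> D" for d using elim(1) that by blast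
    qed (rule D)+
  qed
qed

text \<open>
  Off a measurable null set the weak limit is chosen, and \<open>0\<close> on it; then each inner product with a fixed
  vector is an everywhere limit of random variables.
\<close>

theorem weak_limit_rv:
  assumes "zeros \<noteq> {}"
  obtains xbar where "xbar \<in> borel_measurable M"
    "AE \<omega> in M. xbar \<omega> \<in> zeros \<and> weakly_tendsto (\<lambda>n. x n \<omega>) (xbar \<omega>) \<and>
      (\<lambda>n. B (x n \<omega>)) \<longlonglongrightarrow> B (xbar \<omega>)"
proof -
  let ?lim = "\<lambda>\<omega> l. l \<in> zeros \<and> weakly_tendsto (\<lambda>n. x n \<omega>) l \<and> (\<lambda>n. B (x n \<omega>)) \<longlonglongrightarrow> B l"
  obtain N where N: "\<And>\<omega>. \<omega> \<in> space M - N \<Longrightarrow> \<exists>l\<in>zeros. weakly_tendsto (\<lambda>n. x n \<omega>) l \<and>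
      (\<lambda>n. B (x n \<omega>)) \<longlonglongrightarrow> B l" "N \<in> null_sets M"
    using AE_weak_limit[OF assms] by (rule AE_E3) (rule that)
  define xbar where "xbar \<omega> = (if \<omega> \<in> space M - N then SOME l. ?lim \<omega> l else 0)" for \<omega>
  have lim: "?lim \<omega> (xbar \<omega>)" if "\<omega> \<in> space M - N" for \<omega>
  proof -
    have "\<exists>l. ?lim \<omega> l" using N(1)[OF that] by blast
    from someI_ex[OF this] show ?thesis using that by (simp add: xbar_def)
  qed
  have "xbar \<in> borel_measurable M"
  proof (rule borel_measurable_weak_limit)
    fix h
    show "(\<lambda>\<omega>. xbar \<omega> \<bullet> h) \<in> borel_measurable M"
    proof (rule borel_measurable_LIMSEQ_real)
      have "space M - N \<in> sets M" using N(2) by auto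
      then show "(\<lambda>\<omega>. indicator (space M - N) \<omega> * (x n \<omega> \<bullet> h)) \<in> borel_measurable M" for n
        by (intro borel_measurable_times borel_measurable_indicator borel_measurable_inner
            borel_measurable_const measurable_M[OF x_adapted])
      fix \<omega> assume "\<omega> \<in> space M"
      show "(\<lambda>n. indicator (space M - N) \<omega> * (x n \<omega> \<bullet> h)) \<longlonglongrightarrow> xbar \<omega> \<bullet> h"
      proof (cases "\<omega> \<in> space M - N")
        case True
        then have "(\<lambda>n. x n \<omega> \<bullet> h) \<longlonglongrightarrow> xbar \<omega> \<bullet> h"
          using lim[OF True] unfolding weakly_tendsto_def by blast
        then show ?thesis using True by simp
      next
        case False
        then have "xbar \<omega> = 0" by (simp only: xbar_def if_False)
        then show ?thesis using False by simp
      qed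
    qed
  qed
  moreover have "AE \<omega> in M. ?lim \<omega> (xbar \<omega>)"
    using AE_not_in[OF N(2)] AE_space
  proof eventually_elim
    case (elim \<omega>)
    then show ?case using lim[of \<omega>] by blast
  qed
  ultimately show ?thesis by (rule that)
qed

end

section \<open>Convergence with respect to the natural filtration\<close>

lemma history_measurable:
  assumes "i \<le> n"
  shows "x i \<in> borel_measurable (history M x n)"
proof (rule measurableI)
  have gen: "(\<Union>i\<in>{..n}. {x i -` S \<inter> space M |S. S \<in> sets borel}) \<subseteq> Pow (space M)" by auto
  fix S :: "'b set" assume "S \<in> sets borel"
  then have "x i -` S \<inter> space M \<in> sets (history M x n)"
    unfolding history_def sets_measure_of[OF gen] using assms by (intro sigma_sets.Basic) auto
  then show "x i -` S \<inter> space (history M x n) \<in> sets (history M x n)"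
    by (simp add: history_def space_measure_of[OF gen])
qed simp

lemma sets_history_Suc: "sets (history M x n) \<subseteq> sets (history M x (Suc n))"
proof -
  have gen: "(\<Union>i\<in>{..n}. {x i -` S \<inter> space M |S. S \<in> sets borel}) \<subseteq> Pow (space M)" for n by auto
  show ?thesis
    unfolding history_def sets_measure_of[OF gen] by (intro sigma_sets_mono' UN_mono) auto
qed

lemma demiregular_at_singletonD:
  assumes "demiregular_at (\<lambda>y. {B y}) y" "weakly_tendsto ys y" "(\<lambda>n. B (ys n)) \<longlonglongrightarrow> B y"
  shows "ys \<longlonglongrightarrow> y"
proof -
  have "\<forall>ys vs v. (\<forall>n. (ys n, vs n) \<in> gra (\<lambda>y. {B y})) \<longrightarrow> v \<in> {B y} \<longrightarrow>
      weakly_tendsto ys y \<longrightarrow> vs \<longlonglongrightarrow> v \<longrightarrow> ys \<longlonglongrightarrow> y"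
    using assms(1) unfolding demiregular_at_def by (rule conjunct2)
  from this[rule_format, of ys "\<lambda>n. B (ys n)" "B y"] assms(2,3)
  show ?thesis by (simp add: gra_def)
qed

lemma ex_norm_bound:
  assumes "bounded_linear T"
  shows "\<exists>K>0. \<forall>v. norm (T v) \<le> K * norm v"
  using bounded_linear.pos_bounded[OF assms] by (simp add: mult.commute)

theorem theorem3p2:
  fixes M :: "'o measure"
    and U B :: "'h::{real_inner, banach, second_countable_topology} \<Rightarrow> 'h"
    and A :: "'h \<Rightarrow> 'h set"
    and \<beta> \<epsilon> :: real
    and \<gamma> lam \<alpha> :: "nat \<Rightarrow> real"
    and r x w z p :: "nat \<Rightarrow> 'o \<Rightarrow> 'h"
    and P :: "'h set"
  assumes "prob_space M"
    and "\<beta> > 0"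
    and "bounded_linear U" and "self_adjoint U" and "strongly_positive U"
    and "maximally_monotone A"
    and "\<And>x y. (x - y) \<bullet> (B x - B y) \<ge> \<beta> * ((B x - B y) \<bullet> U (B x - B y))"
    and P: "P = {x. 0 \<in> {u + B x |u. u \<in> A x}}" and "P \<noteq> {}"
    and "0 < \<epsilon>" and "\<epsilon> < min 1 \<beta>"
    and "\<And>n. \<gamma> n \<in> {\<epsilon>..(2 - \<epsilon>) * \<beta>}"
    and "\<And>n. lam n \<in> {\<epsilon>..1}"
    and "\<And>n. \<alpha> n \<in> {0..1 - \<epsilon>}"
    and "\<And>n. square_integrable_rv M (r n)"
    and "square_integrable_rv M (x 0)"
    and "\<And>n \<omega>. \<omega> \<in> space M \<Longrightarrow> w n \<omega> = x n \<omega> + \<alpha> n *\<^sub>R (x n \<omega> - prev x n \<omega>)"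
    and "\<And>n \<omega>. \<omega> \<in> space M \<Longrightarrow> z n \<omega> = w n \<omega> - \<gamma> n *\<^sub>R U (r n \<omega>)"
    and "\<And>n \<omega>. \<omega> \<in> space M \<Longrightarrow> p n \<omega> \<in> resolvent (scaled_op (\<gamma> n) U A) (z n \<omega>)"
    and "\<And>n \<omega>. \<omega> \<in> space M \<Longrightarrow> x (Suc n) \<omega> = x n \<omega> + lam n *\<^sub>R (p n \<omega> - x n \<omega>)"
    and a: "\<And>n. \<exists>g. is_cond_exp M (history M x n) (r n) g \<and> (AE \<omega> in M. g \<omega> = B (w n \<omega>))"
    and b: "AE \<omega> in M. (\<Sum>n. nn_cond_exp M (history M x n)
              (\<lambda>\<omega>'. ennreal ((norm (r n \<omega>' - B (w n \<omega>')))\<^sup>2)) \<omega>) < \<infinity>"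
    and c: "AE \<omega> in M. bdd_above (range (\<lambda>n. (norm (x n \<omega> - prev x n \<omega>))\<^sup>2))"
           "summable \<alpha>"
  shows "\<exists>xbar. xbar \<in> borel_measurable M \<and> (AE \<omega> in M. xbar \<omega> \<in> P) \<and>
    (AE \<omega> in M. weakly_tendsto (\<lambda>n. x n \<omega>) (xbar \<omega>)) \<and>
    (AE \<omega> in M. (\<lambda>n. B (x n \<omega>)) \<longlonglongrightarrow> B (xbar \<omega>)) \<and>
    ((AE \<omega> in M. demiregular_at (\<lambda>y. {B y}) (xbar \<omega>)) \<longrightarrow>
       (AE \<omega> in M. (\<lambda>n. x n \<omega>) \<longlonglongrightarrow> xbar \<omega>))"
proof -
  interpret prob_space M by fact
  obtain V where V: "bounded_linear V" "self_adjoint V" "strongly_positive V"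
    "\<And>v. U (V v) = v" "\<And>v. V (U v) = v"
    using assms(3-5) by (rule strongly_positive_inverse) (rule that)
  obtain \<mu> where \<mu>: "\<mu> > 0" "\<And>v. \<mu> * (norm v)\<^sup>2 \<le> U v \<bullet> v"
    using assms(5) unfolding strongly_positive_def by blast
  obtain \<kappa> where \<kappa>: "\<kappa> > 0" "\<And>v. \<kappa> * (norm v)\<^sup>2 \<le> V v \<bullet> v"
    using V(3) unfolding strongly_positive_def by blast
  obtain K where K: "K > 0" "\<And>v. norm (U v) \<le> K * norm v"
    using ex_norm_bound[OF assms(3)] by blast
  obtain L where L: "L > 0" "\<And>v. norm (V v) \<le> L * norm v"
    using ex_norm_bound[OF V(1)] by blast
  \<comment> \<open>Measurability of the iterates is contained in the hypothesis on conditional expectations: it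
      makes the \<open>\<sigma>\<close>-algebra that they generate a part of the one of \<open>M\<close>.\<close>
  have sub: "subalgebra M (history M x n)" for n
    using a[of n] unfolding is_cond_exp_def by blast
  interpret preconditioned_inclusion U V B A \<beta> \<mu> \<kappa> K L
    by (rule preconditioned_inclusion.intro) (fact assms(2,3,6,7) V \<mu> \<kappa> K L)+
  interpret filtered_prob_space M "history M x"
    by unfold_locales (rule sub sets_history_Suc)+
  have w_adapted: "w n \<in> borel_measurable (history M x n)" for n
  proof -
    have "prev x n \<in> borel_measurable (history M x n)"
      by (cases n) (simp_all add: prev_def history_measurable)
    then have "(\<lambda>\<omega>. x n \<omega> + \<alpha> n *\<^sub>R (x n \<omega> - prev x n \<omega>)) \<in> borel_measurable (history M x n)"
      by (intro borel_measurable_add borel_measurable_scaleR borel_measurable_diff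
          borel_measurable_const history_measurable order_refl)
    then show ?thesis using assms(17) by (subst measurable_cong) simp_all
  qed
  have mean: "(\<integral>\<omega>. indicator D \<omega> *\<^sub>R (r n \<omega> - B (w n \<omega>)) \<partial>M) = 0"
    if D: "D \<in> sets (history M x n)" for n D
  proof -
    obtain g where g: "is_cond_exp M (history M x n) (r n) g" "AE \<omega> in M. g \<omega> = B (w n \<omega>)"
      using a[of n] by blast
    have r_int: "integrable M (r n)" and g_int: "integrable M g"
      and eq: "(\<integral>\<omega>. indicator D \<omega> *\<^sub>R g \<omega> \<partial>M) = (\<integral>\<omega>. indicator D \<omega> *\<^sub>R r n \<omega> \<partial>M)"
      using g(1) D unfolding is_cond_exp_def set_lebesgue_integral_def by blast+
    have DM: "D \<in> sets M" using D sets_F by blast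
    have Bw: "(\<lambda>\<omega>. B (w n \<omega>)) \<in> borel_measurable M"
      by (rule measurable_from_subalg[OF sub borel_measurable_continuous_on[OF B_continuous w_adapted]])
    have "(\<integral>\<omega>. indicator D \<omega> *\<^sub>R (r n \<omega> - B (w n \<omega>)) \<partial>M)
        = (\<integral>\<omega>. indicator D \<omega> *\<^sub>R r n \<omega> - indicator D \<omega> *\<^sub>R g \<omega> \<partial>M)"
    proof (rule integral_cong_AE)
      show "AE \<omega> in M. indicator D \<omega> *\<^sub>R (r n \<omega> - B (w n \<omega>))
          = indicator D \<omega> *\<^sub>R r n \<omega> - indicator D \<omega> *\<^sub>R g \<omega>"
        using g(2) by eventually_elim (simp add: scaleR_diff_right)
    qed (intro borel_measurable_scaleR borel_measurable_diff borel_measurable_indicator DM Bw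
        borel_measurable_integrable[OF r_int] borel_measurable_integrable[OF g_int])+
    also have "\<dots> = (\<integral>\<omega>. indicator D \<omega> *\<^sub>R r n \<omega> \<partial>M) - (\<integral>\<omega>. indicator D \<omega> *\<^sub>R g \<omega> \<partial>M)"
      by (intro Bochner_Integration.integral_diff integrable_mult_indicator DM r_int g_int)
    finally show ?thesis using eq by simp
  qed
  have \<alpha>_le: "\<alpha> n \<le> 1" for n using assms(10) assms(14)[of n] by simp
  interpret stochastic_forward_backward U V B A \<beta> \<mu> \<kappa> K L M "history M x" \<epsilon> \<gamma> lam \<alpha> r x w p
  proof unfold_locales
    show "p n \<omega> \<in> resolvent (scaled_op (\<gamma> n) U A) (w n \<omega> - \<gamma> n *\<^sub>R U (r n \<omega>))"
      if "\<omega> \<in> space M" for n \<omega>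
      using assms(19)[OF that, of n] assms(18)[OF that, of n] by simp
    show "0 < \<epsilon>" by (rule assms(10))
    show "\<epsilon> \<le> \<gamma> n" "\<gamma> n \<le> (2 - \<epsilon>) * \<beta>" for n using assms(12)[of n] by simp_all
    show "\<epsilon> \<le> lam n" "lam n \<le> 1" for n using assms(13)[of n] by simp_all
    show "0 \<le> \<alpha> n" for n using assms(14)[of n] by simp
    show "x n \<in> borel_measurable (history M x n)" for n by (simp add: history_measurable)
  qed (fact assms \<alpha>_le mean b c)+
  have zeros_P: "zeros = P"
  proof -
    have "0 = u + B v \<longleftrightarrow> u = - B v" for u v by (metis eq_neg_iff_add_eq_0)
    then have "0 \<in> {u + B v |u. u \<in> A v} \<longleftrightarrow> - B v \<in> A v" for v by simp
    then show ?thesis by (simp add: zeros_def P)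
  qed
  then have "zeros \<noteq> {}" using assms(9) by simp
  then obtain xbar where xbar: "xbar \<in> borel_measurable M"
    and lim: "AE \<omega> in M. xbar \<omega> \<in> zeros \<and> weakly_tendsto (\<lambda>n. x n \<omega>) (xbar \<omega>) \<and>
      (\<lambda>n. B (x n \<omega>)) \<longlonglongrightarrow> B (xbar \<omega>)"
    by (rule weak_limit_rv)
  show ?thesis
  proof (intro exI conjI impI)
    show "xbar \<in> borel_measurable M" by (rule xbar)
    show "AE \<omega> in M. xbar \<omega> \<in> P" using lim by eventually_elim (simp add: zeros_P)
    show "AE \<omega> in M. weakly_tendsto (\<lambda>n. x n \<omega>) (xbar \<omega>)" using lim by eventually_elim simp
    show "AE \<omega> in M. (\<lambda>n. B (x n \<omega>)) \<longlonglongrightarrow> B (xbar \<omega>)" using lim by eventually_elim simp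
    assume "AE \<omega> in M. demiregular_at (\<lambda>y. {B y}) (xbar \<omega>)"
    then show "AE \<omega> in M. (\<lambda>n. x n \<omega>) \<longlonglongrightarrow> xbar \<omega>"
      using lim
    proof eventually_elim
      case (elim \<omega>)
      from demiregular_at_singletonD[OF elim(1)] elim(2) show ?case by blast
    qed
  qed
qed

end
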